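(* Let $\gamma\colon[a,b]\to\mathbf{R}^3$ be a rectifiable curve with length $L$ and inradius $r$. Then $$L\geq \sqrt{(\pi+2)^2+36}\;r\;(>7.9104\,r).$$ Furthermore, if $\gamma$ is closed (i.e. $\gamma(a)=\gamma(b)$), then $$L\geq 6\sqrt{3}\,r\;(>10.3923\,r).$$
   Context: A curve is a continuous map $\gamma\colon[a,b]\to\mathbf{R}^3$; its length $L$ is the supremum of $\sum_{i}\|\gamma(t_i)-\gamma(t_{i-1})\|$ over all partitions of $[a,b]$, and $\gamma$ is rectifiable if $L<\infty$. The inradius $r$ of $\gamma$ is the supremum of the radii of all spheres which are contained in the convex hull of $\gamma([a,b])$ and are disjoint from $\gamma([a,b])$.
   Formalization: The decimal remarks (>7.9104 r) and (>10.3923 r) are dropped: sqrt((π+2)²+36) is about 7.9016, so the first is false as an evaluation of the constant, and both strict inequalities fail when r = 0; the exact bounds are kept in full. *)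

theory Defs
  imports "HOL-Analysis.Analysis"
begin

definition polygon_lengths :: "(real \<Rightarrow> real^3) \<Rightarrow> real \<Rightarrow> real \<Rightarrow> real set" where
  "polygon_lengths \<gamma> a b =
     {\<Sum>i\<in>{1..n}. norm (\<gamma> (t i) - \<gamma> (t (i - 1))) | n t.
        t 0 = a \<and> t n = b \<and> (\<forall>i<n. t i \<le> t (Suc i))}"

definition curve_length :: "(real \<Rightarrow> real^3) \<Rightarrow> real \<Rightarrow> real \<Rightarrow> real" where
  "curve_length \<gamma> a b = Sup (polygon_lengths \<gamma> a b)"

definition rectifiable :: "(real \<Rightarrow> real^3) \<Rightarrow> real \<Rightarrow> real \<Rightarrow> bool" where
  "rectifiable \<gamma> a b \<longleftrightarrow> bdd_above (polygon_lengths \<gamma> a b)"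

definition inradius :: "(real \<Rightarrow> real^3) \<Rightarrow> real \<Rightarrow> real \<Rightarrow> real" where
  "inradius \<gamma> a b = Sup ({0} \<union> {\<rho>. \<rho> > 0 \<and> (\<exists>x. sphere x \<rho> \<subseteq> convex hull (\<gamma> ` {a..b})
                                      \<and> sphere x \<rho> \<inter> \<gamma> ` {a..b} = {})})"

end

theory Submission
  imports Defs
begin

text \<open>After scaling, the curve contains the vertices of a polygon \<open>z\<close> whose convex hull contains the unit
  ball, i.e. every unit vector \<open>p\<close> satisfies \<open>inner p (z i) \<ge> 1\<close> for some \<open>i\<close>.

  Open curves. By the Borsuk-Ulam theorem there is a direction \<open>p\<close> in which the polygon alternates between
  the two sides of the ball at least four times, so its height varies by at least 6. The projection to the
  plane orthogonal to \<open>p\<close> has length at least \<open>pi + 2\<close>, because its hull contains a unit disc; Minkowski's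
  inequality combines the two. The planar bound is a duality argument: if directions \<open>v\<close> receive weights
  whose partial sums, in the order in which the path reaches \<open>inner v x \<ge> 1\<close>, stay in the unit disc and
  which sum to 0, then the length is at least the total weight. Let \<open>u\<close> be a direction reached before and
  after \<open>-u\<close>. If the directions within 30 degrees of \<open>-u\<close> are all reached in between, weight 1 at both visits of \<open>u\<close>
  and arc length on the opposite half circle give total weight \<open>pi + 2\<close>; otherwise the path zigzags between
  two almost opposite half-planes and is even longer.

  Closed curves. A plane tangent to the sphere at \<open>p\<close> has vertices on both sides, so the closed polygon
  crosses it at least twice. A vertex whose visible cap lies in the cap of a neighbour can be deleted. For
  the remaining edges the measure of the tangent planes crossed is at most \<open>4 * pi / (3 * sqrt 3)\<close> times
  the length, and integrating over the sphere (of measure \<open>4 * pi\<close>) gives \<open>6 * sqrt 3\<close>.\<close>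

subsection \<open>Duality for polygonal paths and the planar bound\<close>

lemma norm_diff_le_path_length:
  fixes z :: "nat \<Rightarrow> 'a::real_normed_vector"
  assumes "i \<le> j"
  shows "norm (z j - z i) \<le> (\<Sum>k\<in>{i..<j}. norm (z (Suc k) - z k))"
  using assms
proof (induction j rule: dec_induct)
  case (step j)
  have "norm (z (Suc j) - z i) \<le> norm (z (Suc j) - z j) + norm (z j - z i)"
    by (metis (no_types) diff_add_cancel norm_triangle_ineq add_diff_eq)
  then show ?case using step by simp
qed simp

lemma sum_inner_by_parts:
  fixes z l :: "nat \<Rightarrow> 'a::real_inner"
  shows "(\<Sum>k\<le>n. inner (l k) (z k)) =
    inner (\<Sum>j\<le>n. l j) (z n) + (\<Sum>k<n. inner (\<Sum>j\<le>k. l j) (z k - z (Suc k)))"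
  by (induction n) (simp_all add: inner_add_left inner_diff_right)

text \<open>Linear programming duality: the weights \<open>l k\<close> form a certificate for a lower bound
  on the length of every polygon whose vertices satisfy \<open>inner (l k) (z k) \<ge> m k\<close>.\<close>

lemma path_length_ge_certificate:
  fixes z l :: "nat \<Rightarrow> 'a::real_inner"
  assumes "\<And>k. k < n \<Longrightarrow> norm (\<Sum>j\<le>k. l j) \<le> 1" and "(\<Sum>j\<le>n. l j) = 0"
  shows "(\<Sum>k\<le>n. inner (l k) (z k)) \<le> (\<Sum>k<n. norm (z (Suc k) - z k))"
proof -
  have "inner (\<Sum>j\<le>k. l j) (z k - z (Suc k)) \<le> norm (z (Suc k) - z k)" if "k < n" for k
  proof -
    have "inner (\<Sum>j\<le>k. l j) (z k - z (Suc k)) \<le> norm (\<Sum>j\<le>k. l j) * norm (z k - z (Suc k))"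
      by (rule norm_cauchy_schwarz)
    also have "\<dots> \<le> norm (z (Suc k) - z k)"
      using assms(1)[OF that] by (simp add: mult_left_le_one_le norm_minus_commute)
    finally show ?thesis .
  qed
  then show ?thesis
    unfolding sum_inner_by_parts assms(2) by (auto intro: sum_mono)
qed

section \<open>Arc integrals on the lower half circle, and the planar bound when a cone is
  covered\<close>

lemma norm_le_if_inner_cis_le:
  fixes w :: complex
  assumes "\<And>\<beta>. -pi/2 \<le> \<beta> \<Longrightarrow> \<beta> \<le> 3*pi/2 \<Longrightarrow> inner (cis \<beta>) w \<le> c" "0 \<le> c"
  shows "norm w \<le> c"
proof (cases "w = 0")
  case False
  define \<beta> where "\<beta> = (if Arg w \<ge> -pi/2 then Arg w else Arg w + 2*pi)"
  have "cis \<beta> = cis (Arg w)"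
    by (simp add: \<beta>_def cis.ctr)
  then have w: "w = of_real (norm w) * cis \<beta>"
    by (metis rcis_cmod_Arg rcis_def)
  have "inner (cis \<beta>) w \<le> c"
    by (rule assms) (use Arg_bounded[of w] in \<open>auto simp: \<beta>_def\<close>)
  moreover have "inner (cis \<beta>) w = norm w"
  proof -
    have "inner (cis \<beta>) w = inner (cis \<beta>) (norm w *\<^sub>R cis \<beta>)"
      using w by (simp add: scaleR_conv_of_real)
    also have "\<dots> = norm w * ((norm (cis \<beta>))\<^sup>2)"
      unfolding inner_scaleR_right power2_norm_eq_inner ..
    finally show ?thesis by simp
  qed
  ultimately show ?thesis by simp
qed (use assms in simp)

lemma inner_cis: "inner (cis a) (cis b) = cos (b - a)"
  by (simp add: inner_complex_def cos_diff)

lemma set_integrable_cis: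
  assumes "S \<in> sets borel" "S \<subseteq> {-pi..0}"
  shows "set_integrable lborel S cis"
  by (rule set_integrable_subset[of _ "{-pi..0}"])
     (use assms in \<open>auto intro!: borel_integrable_atLeastAtMost' continuous_intros\<close>)

lemma set_integrable_cos_diff:
  assumes "S \<in> sets borel" "S \<subseteq> {-pi..0}"
  shows "set_integrable lborel S (\<lambda>t. cos (t - b))"
  by (rule set_integrable_subset[of _ "{-pi..0}"])
     (use assms in \<open>auto intro!: borel_integrable_atLeastAtMost' continuous_intros\<close>)

lemma inner_set_integral_cis:
  assumes "S \<in> sets borel" "S \<subseteq> {-pi..0}"
  shows "inner (cis b) (LINT t:S|lborel. cis t) = (LINT t:S|lborel. cos (t - b))"
  using set_integrable_cis[OF assms] unfolding set_integrable_def set_lebesgue_integral_def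
  by (subst integral_inner_right[symmetric]) (auto simp: inner_cis)

lemma LINT_cos_diff:
  fixes x y b :: real
  assumes "x \<le> y"
  shows "(LINT t:{x..y}|lborel. cos (t - b)) = sin (y - b) - sin (x - b)"
  unfolding set_lebesgue_integral_def
  by (rule integral_FTC_atLeastAtMost[OF assms])
     (auto intro!: derivative_eq_intros continuous_intros
       simp: has_real_derivative_iff_has_vector_derivative[symmetric])

text \<open>Among all \<open>S\<close> in the lower half circle the integral is largest for
  \<open>T\<close>, the part on which the cosine is nonnegative. Let I be the integral of
  \<open>cis\<close> over \<open>S\<close>. By the first claim I + \<i> lies in the unit disc; by
  the second, so does I itself when \<open>S\<close> omits the middle 60 degrees. An arc of 60
  degrees has chord 1, so the middle arc integrates to -\<i>, and its loss cancels the term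
  \<open>- sin b\<close> exactly. The range of \<open>b\<close> is one full turn, started at -pi/2
  so that two formulas describe \<open>T\<close>.\<close>

lemma LINT_cos_lower_le:
  assumes b: "-pi/2 \<le> b" "b \<le> 3*pi/2" and S: "S \<in> sets borel" "S \<subseteq> {-pi..0}"
  shows "(LINT t:S|lborel. cos (t - b)) \<le> 1 - sin b"
    and "S \<inter> {-(2*pi/3)<..<-(pi/3)} = {} \<Longrightarrow> (LINT t:S|lborel. cos (t - b)) \<le> 1"
proof -
  define T where "T = (if b \<le> pi/2 then {b - pi/2..0} else {-pi..b - 3*pi/2})"
  define N where "N = {-(2*pi/3)..-(pi/3)}"
  define N' where "N' = {-(2*pi/3)<..<-(pi/3)}"
  have T: "T \<in> sets borel" "T \<subseteq> {-pi..0}" using b by (auto simp: T_def)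
  have N: "N \<in> sets borel" "N \<subseteq> {-pi..0}" using b by (auto simp: N_def)
  have intT: "(LINT t:T|lborel. cos (t - b)) = 1 - sin b"
  proof (cases "b \<le> pi/2")
    case True
    then show ?thesis using LINT_cos_diff[of "b - pi/2" 0 b] by (simp add: T_def)
  next
    case False
    have "sin (-pi - b) = sin b" using sin_minus[of "pi + b"] by (simp add: sin_add)
    moreover have "sin (-(3*pi/2)) = 1"
      using sin_periodic[of "-(3*pi/2)"] by (simp add: field_simps del: sin_periodic)
    ultimately show ?thesis using LINT_cos_diff[of "-pi" "b - 3*pi/2" b] False b by (simp add: T_def)
  qed
  have pos: "cos (t - b) \<ge> 0" if "t \<in> T" for t
  proof (cases "b \<le> pi/2")
    case True
    then show ?thesis using that b by (intro cos_ge_zero) (auto simp: T_def)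
  next
    case False
    have "cos (t - b) = cos (t - b + 2*pi)" by simp
    also have "\<dots> \<ge> 0" using that b False by (intro cos_ge_zero) (auto simp: T_def)
    finally show ?thesis .
  qed
  have neg: "cos (t - b) \<le> 0" if "t \<in> {-pi..0}" "t \<notin> T" for t
  proof -
    have "cos (t - b + pi) \<ge> 0"
    proof (cases "b \<le> pi/2")
      case True
      then show ?thesis using that b by (intro cos_ge_zero) (auto simp: T_def)
    next
      case False
      then show ?thesis using that b by (intro cos_ge_zero) (auto simp: T_def)
    qed
    then show ?thesis by simp
  qed
  have *: "(LINT t:S|lborel. cos (t - b)) \<le> (LINT t:T|lborel. cos (t - b))"
    using set_integrable_cos_diff[OF S, of b] set_integrable_cos_diff[OF T, of b]
    unfolding set_integrable_def set_lebesgue_integral_def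
    by (rule integral_mono) (use S T pos neg in \<open>auto simp: indicator_def\<close>)
  then show "(LINT t:S|lborel. cos (t - b)) \<le> 1 - sin b" using intT by simp
  assume d: "S \<inter> {-(2*pi/3)<..<-(pi/3)} = {}"
  have N': "N' \<in> sets borel" "N' \<subseteq> {-pi..0}" using b by (auto simp: N'_def)
  \<comment> \<open>The integrands compare pointwise. Off \<open>N'\<close> this is the choice of
    \<open>T\<close>; on \<open>N'\<close> the set \<open>S\<close> contributes nothing, and the
    right side is 0 on \<open>T\<close> and nonnegative elsewhere.\<close>
  have "(LINT t:S|lborel. cos (t - b)) \<le> (LINT t:T|lborel. cos (t - b)) - (LINT t:N'|lborel. cos (t - b))"
  proof -
    have i: "integrable lborel (\<lambda>t. indicat_real X t *\<^sub>R cos (t - b))"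
      if "X \<in> sets borel" "X \<subseteq> {-pi..0}" for X
      using set_integrable_cos_diff[OF that, of b] by (simp add: set_integrable_def)
    have "(LINT t:S|lborel. cos (t - b)) \<le>
      (LINT t|lborel. indicator T t *\<^sub>R cos (t - b) - indicator N' t *\<^sub>R cos (t - b))"
      unfolding set_lebesgue_integral_def
    proof (rule integral_mono[OF i[OF S] Bochner_Integration.integrable_diff[OF i[OF T] i[OF N']]])
      fix t
      show "indicat_real S t *\<^sub>R cos (t - b) \<le> indicat_real T t *\<^sub>R cos (t - b) - indicat_real N' t *\<^sub>R cos (t - b)"
        using S T N' pos[of t] neg[of t] d by (auto simp: indicator_def N'_def[symmetric])
    qed
    also have "\<dots> = (LINT t:T|lborel. cos (t - b)) - (LINT t:N'|lborel. cos (t - b))"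
      unfolding set_lebesgue_integral_def by (rule Bochner_Integration.integral_diff[OF i[OF T] i[OF N']])
    finally show ?thesis .
  qed
  also have "(LINT t:N'|lborel. cos (t - b)) = (LINT t:N|lborel. cos (t - b))"
  proof (rule set_integral_cong_set)
    have "AE t in lborel. t \<noteq> -(2*pi/3) \<and> t \<noteq> -(pi/3)"
      by (intro AE_conjI AE_lborel_singleton)
    then show "AE t in lborel. (t \<in> N) = (t \<in> N')"
      by eventually_elim (auto simp: N_def N'_def)
  qed (use N N' in \<open>auto simp: set_borel_measurable_def\<close>)
  also have "\<dots> = - sin b"
  proof -
    have "(LINT t:N|lborel. cos (t - b)) = sin (-(pi/3) - b) - sin (-(2*pi/3) - b)"
      unfolding N_def by (rule LINT_cos_diff) simp
    also have "\<dots> = - sin b"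
      by (simp add: sin_diff sin_60 cos_60 sin_120 cos_120)
    finally show ?thesis .
  qed
  finally show "(LINT t:S|lborel. cos (t - b)) \<le> 1" using intT by simp
qed

text \<open>Each direction of the lower half circle puts its arc length as weight on a vertex that
  reaches it, and \<open>s\<close> and \<open>t\<close> each receive the weight \<i>. The total
  weight is pi + 2, and the vectors sum to zero because the half circle integrates to -2\<i>. The
  hypothesis \<open>cone\<close> keeps the partial sums in the unit disc before \<open>s\<close> and
  after \<open>t\<close>.\<close>

lemma planar_path_length_ge_if_cone_covered:
  fixes z :: "nat \<Rightarrow> complex"
  assumes st: "s \<le> t" "t \<le> n" and Im: "1 \<le> Im (z s)" "1 \<le> Im (z t)"
    and all: "\<And>x. \<exists>i\<le>n. 1 \<le> inner (cis x) (z i)"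
    and cone: "\<And>x. x \<in> {-(2*pi/3)<..<-(pi/3)} \<Longrightarrow> \<exists>i\<in>{s..t}. 1 \<le> inner (cis x) (z i)"
  shows "pi + 2 \<le> (\<Sum>k<n. norm (z (Suc k) - z k))"
proof -
  define N where "N = {-(2*pi/3)<..<-(pi/3)}"
  \<comment> \<open>\<open>\<kappa> x\<close> is the vertex charged with \<open>cis x\<close>; for
    the middle 60 degrees it is taken between \<open>s\<close> and \<open>t\<close>. Choosing the
    least index makes \<open>\<kappa>\<close> measurable.\<close>
  define \<kappa> where "\<kappa> x = (if x \<in> N then LEAST i. s \<le> i \<and> i \<le> t \<and> 1 \<le> inner (cis x) (z i)
    else LEAST i. 1 \<le> inner (cis x) (z i))" for x
  have \<kappa>N: "s \<le> \<kappa> x \<and> \<kappa> x \<le> t \<and> 1 \<le> inner (cis x) (z (\<kappa> x))" if xN: "x \<in> N" for x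
  proof -
    obtain i where "s \<le> i \<and> i \<le> t \<and> 1 \<le> inner (cis x) (z i)"
      using cone[of x] xN unfolding N_def by (meson atLeastAtMost_iff)
    from LeastI[of "\<lambda>i. s \<le> i \<and> i \<le> t \<and> 1 \<le> inner (cis x) (z i)", OF this] xN
    show ?thesis by (simp add: \<kappa>_def)
  qed
  have \<kappa>: "\<kappa> x \<le> n \<and> 1 \<le> inner (cis x) (z (\<kappa> x))" for x
  proof (cases "x \<in> N")
    case False
    obtain i where "i \<le> n" "1 \<le> inner (cis x) (z i)" using all by blast
    with False show ?thesis
      using LeastI[of "\<lambda>i. 1 \<le> inner (cis x) (z i)" i] Least_le[of "\<lambda>i. 1 \<le> inner (cis x) (z i)" i]
      by (simp add: \<kappa>_def)
  qed (use \<kappa>N st in fastforce)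
  have [measurable]: "N \<in> sets borel" by (simp add: N_def)
  have [measurable]: "\<kappa> \<in> measurable borel (count_space UNIV)"
    unfolding \<kappa>_def inner_complex_def cis.sel by measurable
  define A where "A k = {x. x \<in> {-pi..0} \<and> \<kappa> x = k}" for k
  define B where "B k = {x. x \<in> {-pi..0} \<and> \<kappa> x \<le> k}" for k
  define C where "C k = {x. x \<in> {-pi..0} \<and> \<not> \<kappa> x \<le> k}" for k
  have A: "A k \<in> sets borel" "A k \<subseteq> {-pi..0}" for k unfolding A_def by (measurable, auto)
  have B: "B k \<in> sets borel" "B k \<subseteq> {-pi..0}" for k unfolding B_def by (measurable, auto)
  have C: "C k \<in> sets borel" "C k \<subseteq> {-pi..0}" for k unfolding C_def by (measurable, auto)
  define I where "I S = (LINT x:S|lborel. cis x)" for S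
  define l where "l k = I (A k) + (if k = s then \<i> else 0) + (if k = t then \<i> else 0)" for k
  have IB: "I (B k) = (\<Sum>j\<le>k. I (A j))" for k
  proof -
    have "B k = (\<Union>j\<in>{..k}. A j)" by (auto simp: A_def B_def)
    moreover have "disjoint_family_on A {..k}" by (auto simp: A_def disjoint_family_on_def)
    ultimately show ?thesis
      unfolding I_def using A by (simp add: set_integral_finite_Union set_integrable_cis)
  qed
  have suml: "(\<Sum>j\<le>k. l j) = I (B k) + (if s \<le> k then \<i> else 0) + (if t \<le> k then \<i> else 0)" for k
    by (simp add: l_def sum.distrib IB)
  have IU: "I {-pi..0} = -2 * \<i>"
  proof -
    have "I {-pi..0} = - \<i> * cis 0 - (- \<i> * cis (-pi))"
      unfolding I_def set_lebesgue_integral_def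
      by (rule integral_FTC_atLeastAtMost)
         (auto intro!: derivative_eq_intros continuous_intros has_vector_derivative_real_field
           simp: cis_conv_exp mult.assoc)
    then show ?thesis by (simp add: complex_eq_iff)
  qed
  have BC: "I (B k) + I (C k) = -2 * \<i>" for k
  proof -
    have "B k \<union> C k = {-pi..0}" "B k \<inter> C k = {}" by (auto simp: B_def C_def)
    then have "I {-pi..0} = I (B k) + I (C k)"
      unfolding I_def using set_integral_Un[of "B k" "C k" lborel cis] B C by (simp add: set_integrable_cis)
    then show ?thesis using IU by simp
  qed
  have off: "norm (I S) \<le> 1" if "S \<in> sets borel" "S \<subseteq> {-pi..0}" "S \<inter> N = {}" for S
    using that LINT_cos_lower_le(2) unfolding I_def N_def
    by (intro norm_le_if_inner_cis_le) (auto simp: inner_set_integral_cis)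
  have mid: "norm (I S + \<i>) \<le> 1" if "S \<in> sets borel" "S \<subseteq> {-pi..0}" for S
  proof (rule norm_le_if_inner_cis_le)
    fix b :: real assume "- pi / 2 \<le> b" "b \<le> 3 * pi / 2"
    from LINT_cos_lower_le(1)[OF this that]
    show "inner (cis b) (I S + \<i>) \<le> 1"
      using inner_set_integral_cis[OF that, of b] by (simp add: I_def inner_add_right)
  qed simp
  \<comment> \<open>Before \<open>s\<close> only directions off the middle arc have been charged.
    Between \<open>s\<close> and \<open>t\<close> exactly one \<i> has been added. From
    \<open>t\<close> on, the partial sum is minus the weight still to come, which again avoids the
    middle arc.\<close>
  have "norm (\<Sum>j\<le>k. l j) \<le> 1" for k
  proof -
    consider "k < s" | "s \<le> k" "k < t" | "t \<le> k" using st by linarith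
    then show ?thesis
    proof cases
      case 1
      then have "B k \<inter> N = {}" using \<kappa>N by (fastforce simp: B_def)
      then show ?thesis using 1 st off[OF B] by (simp add: suml)
    next
      case 2
      then show ?thesis using mid[OF B] by (simp add: suml)
    next
      case 3
      then have "C k \<inter> N = {}" using \<kappa>N by (fastforce simp: C_def)
      moreover have "(\<Sum>j\<le>k. l j) = - I (C k)"
      using 3 st BC[of k] unfolding suml by (simp add: eq_neg_iff_add_eq_0 ac_simps)
      ultimately show ?thesis using off[OF C, of k] by simp
    qed
  qed
  moreover have "(\<Sum>j\<le>n. l j) = 0"
  proof -
    have "C n = {}" using \<kappa> by (auto simp: C_def)
    then have "I (B n) = -2 * \<i>" using BC[of n] by (simp add: I_def set_lebesgue_integral_def)
    then show ?thesis using st by (simp add: suml)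
  qed
  ultimately have "(\<Sum>k\<le>n. inner (l k) (z k)) \<le> (\<Sum>k<n. norm (z (Suc k) - z k))"
    by (intro path_length_ge_certificate) auto
  moreover have "pi + 2 \<le> (\<Sum>k\<le>n. inner (l k) (z k))"
  proof -
    have len: "(LINT x:S|lborel. (1::real)) = measure lborel S" if "S \<in> sets borel" "S \<subseteq> {-pi..0}" for S
    proof -
      have "emeasure lborel S \<noteq> \<infinity>"
        using emeasure_mono[of S "{-pi..0}" lborel] that by (auto simp: top_unique)
      then show ?thesis using that by (simp add: set_integral_const)
    qed
    have "measure lborel (A k) \<le> inner (I (A k)) (z k)" for k
    proof -
      have i: "set_integrable lborel (A k) (\<lambda>x. 1::real)"
        by (rule set_integrable_subset[of _ "{-pi..0}"])
           (use A in \<open>auto intro!: borel_integrable_atLeastAtMost' continuous_intros\<close>)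
      have j: "set_integrable lborel (A k) (\<lambda>x. inner (cis x) (z k))"
        by (rule set_integrable_subset[of _ "{-pi..0}"])
           (use A in \<open>auto intro!: borel_integrable_atLeastAtMost' continuous_intros\<close>)
      have "measure lborel (A k) = (LINT x:A k|lborel. 1)" using len A by simp
      also have "\<dots> \<le> (LINT x:A k|lborel. inner (cis x) (z k))"
        using i j by (rule set_integral_mono) (use \<kappa> in \<open>auto simp: A_def\<close>)
      also have "\<dots> = inner (I (A k)) (z k)"
        using set_integrable_cis[OF A, of k] unfolding I_def set_integrable_def set_lebesgue_integral_def
        by (subst integral_inner_left[symmetric]) auto
      finally show ?thesis .
    qed
    then have "(\<Sum>k\<le>n. measure lborel (A k)) \<le> (\<Sum>k\<le>n. inner (I (A k)) (z k))" by (rule sum_mono)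
    moreover have "(\<Sum>k\<le>n. measure lborel (A k)) = pi"
    proof -
      have fin: "emeasure lborel (A k) \<noteq> \<infinity>" for k
        using emeasure_mono[OF A(2)[of k], of lborel] by (auto simp: top_unique)
      have "(\<Sum>k\<le>n. measure lborel (A k)) = measure lborel (\<Union>k\<in>{..n}. A k)"
        by (rule measure_finite_Union[symmetric]) (use A fin in \<open>auto simp: disjoint_family_on_def, auto simp: A_def\<close>)
      also have "(\<Union>k\<in>{..n}. A k) = {-pi..0}" using \<kappa> by (auto simp: A_def)
      finally show ?thesis by simp
    qed
    moreover have "(\<Sum>k\<le>n. inner (l k) (z k)) = (\<Sum>k\<le>n. inner (I (A k)) (z k)) + Im (z s) + Im (z t)"
    proof -
      have "inner (l k) (z k) = inner (I (A k)) (z k) + (if k = s then Im (z s) else 0) + (if k = t then Im (z t) else 0)" for k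
        by (auto simp: l_def inner_add_left)
      then show ?thesis using st by (simp add: sum.distrib)
    qed
    ultimately show ?thesis using Im by linarith
  qed
  ultimately show ?thesis by linarith
qed

section \<open>The zigzag case of the planar bound\<close>

lemma inner_diff_le_norm_diff:
  fixes x y w :: "'a::real_inner"
  assumes "norm w \<le> 1"
  shows "inner w x - inner w y \<le> norm (y - x)"
proof -
  have "inner w (x - y) \<le> norm w * norm (x - y)" by (rule norm_cauchy_schwarz)
  also have "\<dots> \<le> norm (y - x)" using assms by (simp add: mult_left_le_one_le norm_minus_commute)
  finally show ?thesis by (simp add: inner_diff_right)
qed

lemma sum_norm_subpath_le:
  fixes z :: "nat \<Rightarrow> 'a::real_normed_vector"
  assumes "i0 \<le> i1" "i1 \<le> i2" "i2 \<le> i3" "i3 \<le> i4" "i4 \<le> n"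
  shows "norm (z i1 - z i0) + norm (z i2 - z i1) + norm (z i3 - z i2) + norm (z i4 - z i3)
    \<le> (\<Sum>k<n. norm (z (Suc k) - z k))"
proof -
  define P where "P i j = (\<Sum>k\<in>{i..<j}. norm (z (Suc k) - z k))" for i j
  have "P i0 i4 = P i0 i1 + P i1 i2 + P i2 i3 + P i3 i4"
    unfolding P_def using assms by (simp add: sum.atLeastLessThan_concat)
  moreover have "P i0 i4 \<le> (\<Sum>k<n. norm (z (Suc k) - z k))"
    unfolding P_def using assms by (intro sum_mono2) auto
  ultimately show ?thesis
    using norm_diff_le_path_length[of i0 i1 z] norm_diff_le_path_length[of i1 i2 z]
      norm_diff_le_path_length[of i2 i3 z] norm_diff_le_path_length[of i3 i4 z] assms
    unfolding P_def by linarith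
qed

text \<open>A duality certificate with five weights: \<open>a\<close> on \<open>x0\<close>, 2c \<i>
  on \<open>x1\<close>, d \<open>a\<close> and (1 + d) \<open>e\<close> on \<open>x2\<close> and
  \<open>x3\<close> in the order of their visits, and \<i> on \<open>x4\<close>. The partial sums
  are \<open>a\<close>, \<open>w2\<close>, then \<open>w2\<close> plus d \<open>a\<close> or plus (1
  + d) \<open>e\<close>, and finally -\<i>. An angle of at most 30 degrees, that is
  \<open>3/4 \<le> c\<^sup>2\<close>, keeps them in the unit disc.\<close>

lemma zigzag_length_ge:
  fixes x0 x1 x2 x3 x4 :: complex and c s :: real
  assumes c: "3/4 \<le> c\<^sup>2" "0 < c" and cs: "c\<^sup>2 + s\<^sup>2 = 1"
    and x: "1 \<le> inner (Complex s (-c)) x0" "1 \<le> Im x1" "1 \<le> Im x4"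
    and x23: "1 \<le> inner (Complex s (-c)) x2 \<and> 1 \<le> inner (Complex (-s) (-c)) x3 \<or>
          1 \<le> inner (Complex s (-c)) x3 \<and> 1 \<le> inner (Complex (-s) (-c)) x2"
  shows "pi + 2 \<le> norm (x1 - x0) + norm (x2 - x1) + norm (x3 - x2) + norm (x4 - x3)"
proof -
  define a where "a = Complex s (-c)"
  define e where "e = Complex (-s) (-c)"
  \<comment> \<open>The horizontal components of the five weights cancel for every \<open>d\<close>;
    the vertical ones cancel when 2cd = 1.\<close>
  define d where "d = 1 / (2 * c)"
  have d: "d > 0" "d * c = 1/2" using c by (auto simp: d_def)
  have cd: "c * d = 1/2" using d(2) by (simp only: mult.commute)
  have d2: "d\<^sup>2 * c\<^sup>2 = 1/4" using d unfolding power_mult_distrib[symmetric] d(2) by (simp add: power2_eq_square)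
  \<comment> \<open>Adding 2c \<i> reflects \<open>a\<close> in the real axis, so \<open>w2\<close>
    is again a unit vector.\<close>
  define w2 where "w2 = a + (2 * c) *\<^sub>R \<i>"
  have w2: "w2 = Complex s c" by (simp add: w2_def a_def complex_eq_iff)
  have na: "norm a \<le> 1" "norm w2 \<le> 1" using cs by (simp_all add: a_def w2 cmod_def add.commute)
  have dle: "d \<le> c" 
  proof (rule ccontr)
    assume "\<not> d \<le> c"
    then have "c * c < d * c" using c by (intro mult_strict_right_mono) auto
    then show False using c d by (simp add: power2_eq_square)
  qed
  have "norm (w2 + d *\<^sub>R a) \<le> 1"
  proof -
    have "(norm (w2 + d *\<^sub>R a))\<^sup>2 = (s + d * s)\<^sup>2 + (c - 1/2)\<^sup>2"
      by (simp add: w2 a_def cmod_power2 d(2))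
    also have "\<dots> = (c\<^sup>2 + s\<^sup>2) * (1 + 2 * d + d\<^sup>2) - 2 * c * (d * c) - d\<^sup>2 * c\<^sup>2 - c + 1/4"
      by (simp add: power2_eq_square algebra_simps)
    also have "\<dots> = 1 + 2 * d + d\<^sup>2 - 2 * c" unfolding cs d(2) d2 by simp
    also have "\<dots> \<le> 1"
    proof -
      have "d \<le> (2/3) * c"
      proof (rule ccontr)
        assume "\<not> d \<le> (2/3) * c"
        then have "(2/3) * c * c < d * c" using c by (intro mult_strict_right_mono) auto
        then show False using c d by (simp add: power2_eq_square)
      qed
      moreover have "d * d \<le> (2/3) * (d * c)"
        using mult_left_mono[OF \<open>d \<le> (2/3) * c\<close>, of d] d by simp
      moreover have "1/3 \<le> (2/3) * c"
      proof (rule ccontr)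
        assume "\<not> 1/3 \<le> (2/3) * c"
        then have "c < 1/2" by simp
        then have "c * c < 1/2 * (1/2)" using c by (intro mult_strict_mono) auto
        then show False using c by (simp add: power2_eq_square)
      qed
      ultimately show ?thesis using d(2) unfolding power2_eq_square by linarith
    qed
    finally show ?thesis by (simp add: abs_square_le_1)
  qed
  moreover have "norm (w2 + (1 + d) *\<^sub>R e) \<le> 1"
  proof -
    have "(norm (w2 + (1 + d) *\<^sub>R e))\<^sup>2 = (s * d)\<^sup>2 + (1/2)\<^sup>2"
      by (simp add: w2 e_def cmod_power2 algebra_simps d(2) cd)
    also have "\<dots> = d\<^sup>2 * (c\<^sup>2 + s\<^sup>2) - d\<^sup>2 * c\<^sup>2 + 1/4" by (simp add: power2_eq_square algebra_simps)
    also have "\<dots> = d * d" unfolding cs d2 by (simp add: power2_eq_square)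
    also have "\<dots> \<le> d * c" using dle d by (intro mult_left_mono) auto
    also have "\<dots> \<le> 1" using d by simp
    finally show ?thesis by (simp add: abs_square_le_1)
  qed
  ultimately have nw: "norm (w2 + d *\<^sub>R a) \<le> 1" "norm (w2 + (1 + d) *\<^sub>R e) \<le> 1" by auto
  have sumw: "w2 + d *\<^sub>R a + (1 + d) *\<^sub>R e = - \<i>"
    by (simp add: w2 a_def e_def complex_eq_iff algebra_simps d(2) cd)
  then have isum: "inner w2 y + d * inner a y + (1 + d) * inner e y = - Im y" for y
    by (metis inner_add_left inner_scaleR_left inner_minus_left complex_inner_i_left)
  have iw2: "inner w2 y = inner a y + 2 * c * Im y" for y
    by (simp add: w2_def inner_add_left)
  \<comment> \<open>The total weight is 3 + 2c + 2d. Since dc = 1/2, the arithmetic-geometric mean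
    inequality gives 2c + 2d at least sqrt 8 > 2.5 > pi - 1.\<close>
  have "(2 * c + 2 * d)\<^sup>2 = 4 * (c - d)\<^sup>2 + 16 * (d * c)" by (simp add: power2_eq_square algebra_simps)
  then have "(2 * c + 2 * d)\<^sup>2 \<ge> 8" using d by simp
  then have "2 * c + 2 * d \<ge> 2.5"
    using c d by (intro power2_le_imp_le[of "2.5" "2 * c + 2 * d"]) (auto simp: power2_eq_square)
  then have "3 + 2 * c + 2 * d \<ge> pi + 2" using pi_approx by simp
  moreover have "d * p + (1 + d) * q \<ge> 1 + 2 * d" if "p \<ge> 1" "q \<ge> 1" for p q
  proof -
    have "1 + 2 * d = d * 1 + (1 + d) * 1" by simp
    also have "\<dots> \<le> d * p + (1 + d) * q" using d(1) that by (intro add_mono mult_left_mono) auto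
    finally show ?thesis .
  qed
  moreover have "2 * c * Im x1 \<ge> 2 * c * 1" using x(2) c(2) by (intro mult_left_mono) auto
  moreover have "inner a x0 - inner a x1 \<le> norm (x1 - x0)" "inner w2 x1 - inner w2 x2 \<le> norm (x2 - x1)"
    "inner (-\<i>) x3 - inner (-\<i>) x4 \<le> norm (x4 - x3)"
    using na by (intro inner_diff_le_norm_diff; simp)+
  moreover note x23[folded a_def e_def]
  moreover have "inner w2 x2 + d * inner a x2 - inner w2 x3 - d * inner a x3 \<le> norm (x3 - x2)"
    using inner_diff_le_norm_diff[OF nw(1), of x2 x3] by (simp add: inner_add_left)
  moreover have "inner w2 x2 + (1 + d) * inner e x2 - inner w2 x3 - (1 + d) * inner e x3 \<le> norm (x3 - x2)"
    using inner_diff_le_norm_diff[OF nw(2), of x2 x3] by (simp add: inner_add_left)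
  ultimately show ?thesis
    using x[folded a_def] isum[of x3] iw2[of x1]
    by (elim disjE conjE) (smt (verit) inner_minus_left complex_inner_i_left)+
qed

section \<open>Connectedness arguments and the general planar bound\<close>

lemma closed_cover_segment_meets:
  fixes p q :: "'a::real_normed_vector"
  assumes "closed A" "closed B" "closed_segment p q \<subseteq> A \<union> B" "p \<in> A" "q \<in> B"
  obtains x where "x \<in> closed_segment p q" "x \<in> A" "x \<in> B"
  using connected_closedD[OF connected_segment(1)[of p q], of A B] assms by auto

lemma closed_ge_inner_cis:
  "closed {x. \<exists>i\<in>I. 1 \<le> inner (cis (x + c)) (z i)}" if "finite I" for z :: "'i \<Rightarrow> complex"
proof -
  have "closed {x. 1 \<le> inner (cis (x + c)) (z i)}" for i
    by (intro closed_Collect_le continuous_intros)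
  moreover have "{x. \<exists>i\<in>I. 1 \<le> inner (cis (x + c)) (z i)} = (\<Union>i\<in>I. {x. 1 \<le> inner (cis (x + c)) (z i)})" by auto
  ultimately show ?thesis using that by auto
qed

lemma cis_add_pi: "cis (x + pi) = - cis x"
  by (simp add: complex_eq_iff)

text \<open>\<open>E 0\<close> collects the angles whose direction is reached before its opposite by
  some pair of vertices, \<open>E pi\<close> those with the order exchanged. Both sets are closed,
  together they cover the line, and a shift by pi exchanges them, so by connectedness some angle
  lies in both. Of the two pairs of visits obtained, the one ending last supplies the third visit
  and the other supplies the first two.\<close>

lemma planar_path_alternates:
  fixes z :: "nat \<Rightarrow> complex"
  assumes all: "\<And>x. \<exists>i\<le>n. 1 \<le> inner (cis x) (z i)"
  obtains x i j k where "i < j" "j < k" "k \<le> n" "1 \<le> inner (cis x) (z i)" "1 \<le> inner (- cis x) (z j)"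
    "1 \<le> inner (cis x) (z k)"
proof -
  define V where "V x i \<longleftrightarrow> 1 \<le> inner (cis x) (z i)" for x i
  define E where "E c = {x. \<exists>(i, j) \<in> {(i, j). i < j \<and> j \<le> n}. V (x + c) i \<and> V (x + c + pi) j}" for c
  have V_uniq: "\<not> (V x i \<and> V (x + pi) i)" for x i by (simp add: V_def cis_add_pi)
  have "closed (E c)" for c
  proof -
    have fin: "finite {(i, j). i < j \<and> j \<le> n}"
      by (rule finite_subset[of _ "{..n} \<times> {..n}"]) auto
    have "closed {x. V (x + c) i \<and> V (x + c + pi) j}" for i j
      unfolding V_def by (intro closed_Collect_conj closed_Collect_le continuous_intros)
    moreover have "E c = (\<Union>(i, j) \<in> {(i, j). i < j \<and> j \<le> n}. {x. V (x + c) i \<and> V (x + c + pi) j})"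
      by (auto simp: E_def)
    ultimately show ?thesis using fin by (auto intro: closed_Union)
  qed
  moreover have cov: "x \<in> E 0 \<union> E pi" for x
  proof -
    obtain i j where "i \<le> n" "V x i" "j \<le> n" "V (x + pi) j" using all unfolding V_def by blast
    moreover have "i \<noteq> j" using calculation V_uniq by auto
    moreover have "V (x + pi + pi) i" using \<open>V x i\<close> unfolding V_def cis_add_pi by simp
    ultimately show ?thesis by (cases "i < j") (auto simp: E_def)
  qed
  moreover obtain y where y: "y \<in> E 0 \<and> y + pi \<in> E pi \<or> y \<in> E pi \<and> y + pi \<in> E 0"
  proof (cases "0 \<in> E 0")
    case True
    then have "- pi \<in> E pi \<and> -pi + pi \<in> E 0" by (simp add: E_def)
    then show ?thesis using that by blast
  next
    case False
    then have "0 \<in> E pi \<and> 0 + pi \<in> E 0" using cov[of 0] by (auto simp: E_def)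
    then show ?thesis using that by blast
  qed
  moreover obtain x where x: "x \<in> E 0" "x \<in> E pi"
  proof -
    have "\<exists>x. x \<in> E 0 \<and> x \<in> E pi"
      using y
    proof
      assume "y \<in> E 0 \<and> y + pi \<in> E pi"
      then show ?thesis
        using closed_cover_segment_meets[of "E 0" "E pi" y "y + pi"] calculation(1)[of 0] calculation(1)[of pi] cov by blast
    next
      assume "y \<in> E pi \<and> y + pi \<in> E 0"
      then show ?thesis
        using closed_cover_segment_meets[of "E pi" "E 0" y "y + pi"] calculation(1)[of 0] calculation(1)[of pi] cov by blast
    qed
    then show ?thesis using that by blast
  qed
  have V2: "V (x + pi + pi) i = V x i" for i unfolding V_def cis_add_pi by simp
  obtain i j where ij: "i < j" "j \<le> n" "V x i" "V (x + pi) j"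
    using x(1) by (auto simp: E_def)
  obtain i' j' where ij': "i' < j'" "j' \<le> n" "V (x + pi) i'" "V x j'"
    using x(2) V2 unfolding E_def by blast
  have ne: "j \<noteq> j'" "i \<noteq> i'" using V_uniq ij ij' by blast+
  show thesis
  proof (cases "j < j'")
    case True
    show ?thesis
      by (rule that[of i j j' x]) (use True ij ij' in \<open>simp_all add: V_def cis_add_pi\<close>)
  next
    case False
    show ?thesis
      by (rule that[of i' j' j "x + pi"]) (use False ij ij' ne in \<open>simp_all add: V_def cis_add_pi\<close>)
  qed
qed

theorem planar_path_length_ge:
  fixes z :: "nat \<Rightarrow> complex"
  assumes all: "\<And>x. \<exists>i\<le>n. 1 \<le> inner (cis x) (z i)"
  shows "pi + 2 \<le> (\<Sum>k<n. norm (z (Suc k) - z k))"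
proof -
  obtain u s j t where sjt: "s < j" "j < t" "t \<le> n" "1 \<le> inner (cis u) (z s)" "1 \<le> inner (- cis u) (z j)"
    "1 \<le> inner (cis u) (z t)"
    using planar_path_alternates[OF all] .
  \<comment> \<open>The rotation that turns \<open>cis u\<close> into \<i>.\<close>
  define y where "y k = cis (pi/2 - u) * z k" for k
  have iy: "inner (cis x) (y k) = inner (cis (x + u - pi/2)) (z k)" for x k
  proof -
    have *: "inner (cis v) w = Re (cis (- v) * w)" for v w by (simp add: inner_complex_def)
    show ?thesis
      unfolding * y_def mult.assoc[symmetric] cis_mult by (simp add: algebra_simps)
  qed
  have lens: "(\<Sum>k<n. norm (z (Suc k) - z k)) = (\<Sum>k<n. norm (y (Suc k) - y k))"
    by (simp add: y_def right_diff_distrib[symmetric] norm_mult)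
  have ally: "\<exists>i\<le>n. 1 \<le> inner (cis x) (y i)" for x using all iy by metis
  have st: "1 \<le> Im (y s)" "1 \<le> Im (y t)"
    using iy[of "pi/2" s] iy[of "pi/2" t] sjt by simp_all
  have yj: "1 \<le> inner (cis (- (pi/2))) (y j)"
    using iy[of "-pi/2" j] sjt cis_add_pi[of "u - pi"] by (simp add: algebra_simps)
  \<comment> \<open>Angles \<psi> are measured from -\<i>. \<open>In\<close> collects those reached
    between \<open>s\<close> and \<open>t\<close>, \<open>Out\<close> those reached outside this
    stretch.\<close>
  define dir where "dir \<psi> = cis (\<psi> + - (pi/2))" for \<psi> :: real
  define In where "In = {\<psi>. \<exists>i\<in>{s..t}. 1 \<le> inner (dir \<psi>) (y i)}"
  define Out where "Out = {\<psi>. \<exists>i\<in>{..n} - {s..t}. 1 \<le> inner (dir \<psi>) (y i)}"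
  have cl: "closed In" "closed Out" unfolding In_def Out_def dir_def by (rule closed_ge_inner_cis, simp)+
  have cov: "In \<union> Out = UNIV" using ally unfolding In_def Out_def dir_def by blast
  have In0: "0 \<in> In" using yj sjt by (auto simp: In_def dir_def intro!: bexI[of _ j])
  show ?thesis
  proof (cases "{- (pi/6)<..<pi/6} \<subseteq> In")
    case True
    have "\<exists>i\<in>{s..t}. 1 \<le> inner (cis x) (y i)" if "x \<in> {-(2*pi/3)<..<-(pi/3)}" for x
    proof -
      have "x + pi/2 \<in> {- (pi/6)<..<pi/6}" using that by auto
      then have "x + pi/2 \<in> In" using True by blast
      then show ?thesis by (simp add: In_def dir_def)
    qed
    then show ?thesis
      unfolding lens using planar_path_length_ge_if_cone_covered[of s t n y] sjt st ally by auto
  next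
    case False
    then obtain p where p: "\<bar>p\<bar> < pi/6" "p \<notin> In" by (force simp: abs_less_iff)
    \<comment> \<open>Let \<open>a\<close> be an element of \<open>D\<close> of least absolute
      value. Then \<open>- a\<close> is in \<open>In\<close>: otherwise the segment from 0 to
      \<open>- a\<close> contains an element of \<open>D\<close>, which by minimality could only be
      \<open>a\<close>, and \<open>a\<close> is not on that segment. So \<open>a\<close> and
      \<open>- a\<close> are both reached inside the stretch, and \<open>a\<close> is reached
      outside it as well.\<close>
    define D where "D = In \<inter> Out \<inter> cball 0 \<bar>p\<bar>"
    have seg: "\<bar>x\<bar> \<le> \<bar>q\<bar>" if "x \<in> closed_segment 0 q" for x q :: real
      using that segment_bound(1)[of x 0 q] by simp
    have meet: "\<exists>x \<in> closed_segment 0 q. x \<in> In \<inter> Out" if "q \<notin> In" for q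
      using closed_cover_segment_meets[OF cl, of 0 q] cov In0 that by auto
    have "D \<noteq> {}" using meet[OF p(2)] seg by (fastforce simp: D_def)
    moreover have "compact D" using cl by (auto simp: D_def closed_Int_compact)
    ultimately obtain a where a: "a \<in> D" "\<And>x. x \<in> D \<Longrightarrow> \<bar>a\<bar> \<le> \<bar>x\<bar>"
      using continuous_attains_inf[of D abs] continuous_on_rabs[OF continuous_on_id] by (auto simp: id_def)
    have "- a \<in> In"
    proof (rule ccontr)
      assume na: "- a \<notin> In"
      from meet[OF this] obtain x where x: "x \<in> closed_segment 0 (-a)" "x \<in> In \<inter> Out" by blast
      have "\<bar>x\<bar> \<le> \<bar>a\<bar>" using seg[OF x(1)] by simp
      moreover have "x \<in> D" using x a(1) calculation by (auto simp: D_def)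
      ultimately have "\<bar>x\<bar> = \<bar>a\<bar>" using a(2) by fastforce
      moreover have "x \<noteq> - a" using x na by auto
      ultimately have "x = a" "a \<noteq> 0" by linarith+
      then show False using x(1) by (auto simp: closed_segment_eq_real_ivl split: if_splits)
    qed
    then obtain e where e: "e \<in> {s..t}" "1 \<le> inner (dir (-a)) (y e)" by (auto simp: In_def)
    obtain q where q: "q \<in> {s..t}" "1 \<le> inner (dir a) (y q)" using a(1) by (auto simp: In_def D_def)
    obtain r where r: "r \<le> n" "r \<notin> {s..t}" "1 \<le> inner (dir a) (y r)" using a(1) by (auto simp: Out_def D_def)
    have dir: "dir a = Complex (sin a) (- cos a)" "dir (-a) = Complex (- sin a) (- cos a)"
      by (simp_all add: dir_def complex_eq_iff cos_diff sin_diff)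
    have "\<bar>a\<bar> \<le> pi/6" using a(1) p(1) by (auto simp: D_def)
    then have "cos (pi/6) \<le> cos \<bar>a\<bar>" by (intro cos_monotone_0_pi_le) auto
    then have ca: "sqrt 3 / 2 \<le> cos a" by (simp add: cos_30)
    then have "(sqrt 3 / 2)\<^sup>2 \<le> (cos a)\<^sup>2" by (intro power_mono) auto
    then have c2: "3/4 \<le> (cos a)\<^sup>2" by (simp add: power_divide)
    have c0: "0 < cos a" using ca by (meson half_gt_zero less_le_trans real_sqrt_gt_zero zero_less_numeral)
    note zz = zigzag_length_ge[OF c2 c0 sin_cos_squared_add2]
    note r' = r(3)[unfolded dir] and q' = q(2)[unfolded dir] and e' = e(2)[unfolded dir]
    \<comment> \<open>If \<open>r\<close> comes after \<open>t\<close>, the zigzag is read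
      backwards, from \<open>r\<close> through \<open>t\<close> to \<open>s\<close>.\<close>
    consider "r < s" "q \<le> e" | "r < s" "e \<le> q" | "t < r" "q \<le> e" | "t < r" "e \<le> q"
      using r(2) by fastforce
    then show ?thesis
    proof cases
      case 1
      then show ?thesis unfolding lens
        using sum_norm_subpath_le[of r s q e t n y] zz[of "y r" "y s" "y t" "y q" "y e"] r' q' e' st q(1) e(1) sjt by simp
    next
      case 2
      then show ?thesis unfolding lens
        using sum_norm_subpath_le[of r s e q t n y] zz[of "y r" "y s" "y t" "y e" "y q"] r' q' e' st q(1) e(1) sjt by simp
    next
      case 3
      then show ?thesis unfolding lens
        using sum_norm_subpath_le[of s q e t r n y] zz[of "y r" "y t" "y s" "y e" "y q"] r' q' e' st q(1) e(1) r(1)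
        by (simp add: norm_minus_commute)
    next
      case 4
      then show ?thesis unfolding lens
        using sum_norm_subpath_le[of s e q t r n y] zz[of "y r" "y t" "y s" "y q" "y e"] r' q' e' st q(1) e(1) r(1)
        by (simp add: norm_minus_commute)
    qed
  qed
qed

subsection \<open>The Borsuk-Ulam theorem and open polygons\<close>

text \<open>If \<open>f\<close> has no zero, its restriction to the upper hemisphere, parametrised
  by the disc through \<open>E\<close>, has a continuous logarithm \<open>h\<close>. On the boundary
  circle oddness makes \<open>k\<close>, the difference of \<open>h\<close> at antipodal points, a
  logarithm of -1, so its imaginary part never vanishes. But a half turn changes the sign of
  \<open>k\<close>, contradicting the intermediate value theorem.\<close>

theorem borsuk_ulam_sphere_complex:
  fixes f :: "real^3 \<Rightarrow> complex"
  assumes cont: "continuous_on (sphere 0 1) f" and odd: "\<And>x. norm x = 1 \<Longrightarrow> f (- x) = - f x"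
  obtains x where "norm x = 1" "f x = 0"
proof (rule ccontr)
  assume "\<not> thesis"
  then have nz: "f x \<noteq> 0" if "norm x = 1" for x using that \<open>\<not> thesis\<close> by (metis \<open>\<And>x. \<lbrakk>norm x = 1; f x = 0\<rbrakk> \<Longrightarrow> thesis\<close>)
  define E :: "complex \<Rightarrow> real^3" where "E z = vector [Re z, Im z, sqrt (1 - (norm z)\<^sup>2)]" for z
  have normE: "norm (E z) = 1" if "z \<in> cball 0 1" for z
  proof -
    have "(norm z)\<^sup>2 \<le> 1" using that by (simp add: power_le_one)
    then have "inner (E z) (E z) = 1"
      by (simp add: E_def inner_vec_def sum_3 vector_3 cmod_power2 power2_eq_square[symmetric])
    then show ?thesis by (simp add: norm_eq_sqrt_inner)
  qed
  have contE: "continuous_on S E" for S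
  proof -
    have "continuous_on S (\<lambda>z. E z $ i)" for i
      using exhaust_3[of i] by (elim disjE; simp add: E_def vector_3; intro continuous_intros)
    then show ?thesis by (intro continuous_on_vec_lambda[of S "\<lambda>i z. E z $ i", simplified])
  qed
  have "continuous_on (cball 0 1) (f \<circ> E)"
    by (rule continuous_on_compose[OF contE]) (use cont normE in \<open>auto intro: continuous_on_subset\<close>)
  moreover have "(f \<circ> E) z \<noteq> 0" if "z \<in> cball 0 1" for z using nz normE that by simp
  ultimately obtain h where h: "continuous_on (cball 0 1) h" "\<And>z. z \<in> cball 0 1 \<Longrightarrow> (f \<circ> E) z = exp (h z)"
    using continuous_logarithm_on_cball by metis
  define k where "k t = h (cis (t + pi)) - h (cis t)" for t
  have "continuous_on UNIV (\<lambda>t. h (cis (t + c)))" for c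
    by (rule continuous_on_compose2[OF h(1)]) (auto intro!: continuous_intros)
  from this[of pi] this[of 0] have "continuous_on UNIV k" unfolding k_def by (auto intro!: continuous_intros)
  then have contk: "continuous_on UNIV (\<lambda>t. Im (k t))" by (intro continuous_intros)
  have expk: "exp (k t) = -1" for t
  proof -
    have "E (cis (t + pi)) = - E (cis t)"
      unfolding E_def vec_eq_iff forall_3 by (simp add: vector_3)
    then have "exp (h (cis (t + pi))) = - exp (h (cis t))"
      using h(2)[of "cis (t + pi)"] h(2)[of "cis t"] odd[of "E (cis t)"] normE[of "cis t"] by simp
    then show ?thesis by (simp add: k_def exp_diff)
  qed
  have "Im (k pi) = - Im (k 0)"
    by (simp add: k_def cis_add_pi[of pi, simplified] cis.ctr)
  then obtain t where "Im (k t) = 0"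
  proof (cases "Im (k 0) \<le> 0")
    case True
    then show ?thesis
      using IVT'[of "\<lambda>t. Im (k t)" 0 0 pi] that contk \<open>Im (k pi) = - Im (k 0)\<close>
      by (metis continuous_on_subset neg_0_le_iff_le pi_ge_zero subset_UNIV)
  next
    case False
    then show ?thesis
      using IVT2'[of "\<lambda>t. Im (k t)" pi 0 0] that contk \<open>Im (k pi) = - Im (k 0)\<close>
      by (metis continuous_on_subset linear neg_le_0_iff_le pi_ge_zero subset_UNIV)
  qed
  then have "exp (k t) = of_real (exp (Re (k t)))"
    by (metis complex_eq_iff complex_of_real_def exp_of_real Re_complex_of_real Im_complex_of_real)
  then have "exp (Re (k t)) = -1" using expk[of t] by (metis of_real_eq_iff of_real_minus of_real_1)
  then show False using exp_gt_zero[of "Re (k t)"] by linarith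
qed

text \<open>The quadratic \<open>Q\<close> with zeros at the first and last support points of
  \<open>b\<close> is nonpositive on the support of \<open>b\<close>. If \<open>a\<close> had no
  mass strictly between these points, \<open>Q\<close> would be positive on the support of
  \<open>a\<close>, whereas equal moments give both weights the same sum against
  \<open>Q\<close>.\<close>

lemma weight_between_if_moments_eq:
  fixes a b :: "nat \<Rightarrow> real"
  assumes nonneg: "\<And>i. 0 \<le> a i" "\<And>i. 0 \<le> b i" and disj: "\<And>i. a i = 0 \<or> b i = 0"
    and m0: "(\<Sum>i\<le>n. a i) = 1" "(\<Sum>i\<le>n. b i) = 1"
    and m1: "(\<Sum>i\<le>n. real i * a i) = (\<Sum>i\<le>n. real i * b i)"
    and m2: "(\<Sum>i\<le>n. (real i)\<^sup>2 * a i) = (\<Sum>i\<le>n. (real i)\<^sup>2 * b i)"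
  obtains p m q where "p < m" "m < q" "q \<le> n" "0 < b p" "0 < a m" "0 < b q"
    "\<And>i. i \<le> n \<Longrightarrow> 0 < b i \<Longrightarrow> p \<le> i \<and> i \<le> q"
proof -
  define B where "B = {i. i \<le> n \<and> 0 < b i}"
  have "finite B" by (simp add: B_def)
  have ex: "\<exists>i\<le>n. 0 < c i" if "(\<Sum>i\<le>n. c i) = 1" "\<And>i. 0 \<le> c i" for c :: "nat \<Rightarrow> real"
  proof (rule ccontr)
    assume "\<not> ?thesis"
    then have "(\<Sum>i\<le>n. c i) = 0" using that(2) by (intro sum.neutral) (auto intro: antisym simp: not_less)
    then show False using that by simp
  qed
  have "B \<noteq> {}" using ex[OF m0(2)] nonneg by (auto simp: B_def)
  define p q where "p = Min B" and "q = Max B"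
  have p: "p \<le> n" "0 < b p" and q: "q \<le> n" "0 < b q"
    using Min_in[OF \<open>finite B\<close> \<open>B \<noteq> {}\<close>] Max_in[OF \<open>finite B\<close> \<open>B \<noteq> {}\<close>] by (auto simp: p_def q_def B_def)
  have pq: "p \<le> i \<and> i \<le> q" if "i \<le> n" "0 < b i" for i
    using \<open>finite B\<close> that by (auto simp: p_def q_def B_def)
  define Q where "Q i = (real i - real p) * (real i - real q)" for i
  have Q: "(\<Sum>i\<le>n. Q i * a i) = (\<Sum>i\<le>n. Q i * b i)"
  proof -
    have "(\<Sum>i\<le>n. Q i * c i) = (\<Sum>i\<le>n. (real i)\<^sup>2 * c i) - (real p + real q) * (\<Sum>i\<le>n. real i * c i)
      + real p * real q * (\<Sum>i\<le>n. c i)" for c :: "nat \<Rightarrow> real"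
      by (simp add: Q_def sum_distrib_left sum.distrib[symmetric] sum_subtractf[symmetric] algebra_simps power2_eq_square)
    then show ?thesis using m0 m1 m2 by simp
  qed
  have ne: "i \<noteq> p \<and> i \<noteq> q" if "0 < a i" for i using disj[of i] p q that by auto
  obtain k where k: "k \<le> n" "0 < a k" using ex[OF m0(1)] nonneg by auto
  have Qb: "(\<Sum>i\<le>n. Q i * b i) \<le> 0"
  proof (rule sum_nonpos)
    fix i assume "i \<in> {..n}"
    then have "Q i \<le> 0 \<or> b i = 0"
      using pq[of i] nonneg(2)[of i] unfolding Q_def by (cases "b i = 0") (auto intro!: mult_nonneg_nonpos)
    then show "Q i * b i \<le> 0" using nonneg(2)[of i] by (auto simp: mult_nonpos_nonneg)
  qed
  have "\<exists>m\<le>n. 0 < a m \<and> p < m \<and> m < q"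
  proof (rule ccontr)
    assume out: "\<not> ?thesis"
    have Qpos: "0 < Q i" if "i \<le> n" "0 < a i" for i
    proof -
      have "i < p \<and> i < q \<or> p < i \<and> q < i" using out that ne[of i] pq[OF p] by (meson linorder_neqE_nat order_less_le_trans)
      then show ?thesis by (auto simp: Q_def zero_less_mult_iff)
    qed
    have "0 \<le> Q i * a i" if "i \<le> n" for i
      using Qpos[OF that] nonneg(1)[of i] by (cases "a i = 0") (auto simp: less_le)
    then have "0 < (\<Sum>i\<le>n. Q i * a i)"
      by (intro sum_pos2[of _ k]) (use k Qpos in auto)
    then show False using Q Qb by simp
  qed
  then show thesis using p q pq that by blast
qed

text \<open>Two disjointly supported weights with equal moments up to order 2 cannot be separated by a
  quadratic polynomial, hence their supports alternate at least four times.\<close>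

lemma weights_alternate_if_moments_eq:
  fixes a b :: "nat \<Rightarrow> real"
  assumes nonneg: "\<And>i. 0 \<le> a i" "\<And>i. 0 \<le> b i" and disj: "\<And>i. a i = 0 \<or> b i = 0"
    and m0: "(\<Sum>i\<le>n. a i) = 1" "(\<Sum>i\<le>n. b i) = 1"
    and m1: "(\<Sum>i\<le>n. real i * a i) = (\<Sum>i\<le>n. real i * b i)"
    and m2: "(\<Sum>i\<le>n. (real i)\<^sup>2 * a i) = (\<Sum>i\<le>n. (real i)\<^sup>2 * b i)"
  obtains i j k l where "i < j" "j < k" "k < l" "l \<le> n"
    "0 < a i \<and> 0 < b j \<and> 0 < a k \<and> 0 < b l \<or> 0 < b i \<and> 0 < a j \<and> 0 < b k \<and> 0 < a l"
proof -
  obtain p m q where b: "p < m" "m < q" "q \<le> n" "0 < b p" "0 < a m" "0 < b q"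
    "\<And>i. i \<le> n \<Longrightarrow> 0 < b i \<Longrightarrow> p \<le> i \<and> i \<le> q"
    using weight_between_if_moments_eq[OF assms] by blast
  obtain p' m' q' where a: "p' < m'" "m' < q'" "q' \<le> n" "0 < a p'" "0 < b m'" "0 < a q'"
    "\<And>i. i \<le> n \<Longrightarrow> 0 < a i \<Longrightarrow> p' \<le> i \<and> i \<le> q'"
    using weight_between_if_moments_eq[OF nonneg(2,1) _ m0(2,1) m1[symmetric] m2[symmetric]] disj by blast
  \<comment> \<open>The weight whose support starts first supplies the first index; the three
    indices found for the other weight follow.\<close>
  consider "p' < p" | "p < p'" using disj a b by (metis less_irrefl linorder_neqE_nat)
  then show thesis
  proof cases
    case 1
    then show ?thesis using that[of p' p m q] a b by blast
  next
    case 2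
    then show ?thesis using that[of p p' m' q'] a b by blast
  qed
qed

text \<open>The vertices above height 1 in direction \<open>p\<close>, and those below -1, get
  probability weights proportional to their excess. Normalisation equates the zeroth moments; the
  differences of the first two moments of the vertex index form the odd map \<open>f\<close> into
  the plane. At a zero from Borsuk-Ulam the supports alternate; if the pattern starts below,
  \<open>- p\<close> is taken instead.\<close>

lemma direction_path_alternates:
  fixes z :: "nat \<Rightarrow> real^3"
  assumes all: "\<And>p. norm p = 1 \<Longrightarrow> \<exists>i\<le>n. 1 < inner p (z i)"
  obtains p i j k l where "norm p = 1" "i < j" "j < k" "k < l" "l \<le> n"
    "1 < inner p (z i)" "inner p (z j) < -1" "1 < inner p (z k)" "inner p (z l) < -1"
proof -
  define \<alpha> where "\<alpha> i p = max 0 (inner p (z i) - 1)" for i p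
  define S where "S p = (\<Sum>i\<le>n. \<alpha> i p)" for p
  define c where "c i p = \<alpha> i p / S p - \<alpha> i (- p) / S (- p)" for i p
  define f where "f p = Complex (\<Sum>i\<le>n. real i * c i p) (\<Sum>i\<le>n. (real i)\<^sup>2 * c i p)" for p
  have \<alpha>_nonneg: "0 \<le> \<alpha> i p" for i p by (simp add: \<alpha>_def)
  have S_pos: "0 < S p" if "norm p = 1" for p
  proof -
    obtain i where "i \<le> n" "1 < inner p (z i)" using all[OF \<open>norm p = 1\<close>] by blast
    then show ?thesis unfolding S_def by (intro sum_pos2[of _ i]) (auto simp: \<alpha>_def)
  qed
  have cont: "continuous_on T (\<alpha> i)" "continuous_on T S" for i T
    unfolding \<alpha>_def S_def by (intro continuous_intros)+
  have cont_minus: "continuous_on T (\<lambda>p. \<alpha> i (- p))" "continuous_on T (\<lambda>p. S (- p))" for i T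
    unfolding \<alpha>_def S_def by (intro continuous_intros)+
  have S_ne: "S p \<noteq> 0 \<and> S (- p) \<noteq> 0" if "norm p = 1" for p
    using S_pos[of p] S_pos[of "- p"] that by auto
  have "continuous_on (sphere 0 1) f"
    unfolding f_def c_def Complex_eq
    by (intro continuous_intros cont cont_minus) (use S_ne in auto)
  moreover have "f (- p) = - f p" for p
    by (simp add: f_def c_def complex_eq_iff sum_negf[symmetric] algebra_simps)
  ultimately obtain p where p: "norm p = 1" "f p = 0"
    using borsuk_ulam_sphere_complex by metis
  define a b where "a i = \<alpha> i p / S p" and "b i = \<alpha> i (- p) / S (- p)" for i
  have pos: "0 < S p" "0 < S (- p)" using S_pos p by auto
  have cab: "c i p = a i - b i" for i by (simp add: c_def a_def b_def)
  have "(\<Sum>i\<le>n. real i * a i) = (\<Sum>i\<le>n. real i * b i)" "(\<Sum>i\<le>n. (real i)\<^sup>2 * a i) = (\<Sum>i\<le>n. (real i)\<^sup>2 * b i)"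
    using p(2) by (simp_all add: f_def cab complex_eq_iff right_diff_distrib sum_subtractf)
  moreover have "(\<Sum>i\<le>n. a i) = 1" "(\<Sum>i\<le>n. b i) = 1"
    using pos by (simp_all add: a_def b_def sum_divide_distrib[symmetric] S_def[symmetric])
  moreover have "0 \<le> a i" "0 \<le> b i" for i
    using pos \<alpha>_nonneg by (simp_all add: a_def b_def)
  moreover have "a i = 0 \<or> b i = 0" for i by (auto simp: a_def b_def \<alpha>_def)
  ultimately obtain i j k l where ijkl: "i < j" "j < k" "k < l" "l \<le> n"
    "0 < a i \<and> 0 < b j \<and> 0 < a k \<and> 0 < b l \<or> 0 < b i \<and> 0 < a j \<and> 0 < b k \<and> 0 < a l"
    using weights_alternate_if_moments_eq[of a b n] by blast
  have gt: "1 < inner p (z i)" if "0 < a i" for i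
    using that pos by (auto simp: a_def \<alpha>_def zero_less_divide_iff max_def split: if_splits)
  have lt: "inner p (z i) < -1" if "0 < b i" for i
    using that pos by (auto simp: b_def \<alpha>_def zero_less_divide_iff max_def split: if_splits)
  from ijkl(5) show thesis
  proof
    assume "0 < a i \<and> 0 < b j \<and> 0 < a k \<and> 0 < b l"
    then show thesis using that[of p i j k l] ijkl p gt lt by blast
  next
    assume *: "0 < b i \<and> 0 < a j \<and> 0 < b k \<and> 0 < a l"
    have m: "1 < inner (- p) x \<longleftrightarrow> inner p x < -1" "inner (- p) x < -1 \<longleftrightarrow> 1 < inner p x" for x by auto
    show thesis
      by (rule that[of "- p" i j k l]) (use * ijkl p gt lt in \<open>simp_all add: m del: inner_minus_left\<close>)
  qed
qed

section \<open>Combining the height variation with the planar projection\<close>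

lemma orthonormal_completion_3:
  fixes p :: "real^3"
  assumes "norm p = 1"
  obtains e1 e2 where "norm e1 = 1" "norm e2 = 1" "inner e1 e2 = 0" "inner e1 p = 0" "inner e2 p = 0"
    "\<And>v. (norm v)\<^sup>2 = (inner e1 v)\<^sup>2 + (inner e2 v)\<^sup>2 + (inner p v)\<^sup>2"
proof -
  have "norm (axis 3 1 :: real^3) = 1" by (simp add: norm_eq_1 inner_axis_axis)
  from orthogonal_transformation_exists_1[OF this assms]
  obtain f where f: "orthogonal_transformation f" "f (axis 3 1 :: real^3) = p" .
  have inn: "inner (f x) (f y) = inner x y" for x y
    using f(1) by (simp add: orthogonal_transformation_def)
  have "(norm v)\<^sup>2 = (inner (f (axis 1 1)) v)\<^sup>2 + (inner (f (axis 2 1)) v)\<^sup>2 + (inner p v)\<^sup>2" for v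
  proof -
    obtain w where w: "v = f w"
      using orthogonal_transformation_surj[OF f(1)] by (metis surjD)
    have "(norm v)\<^sup>2 = inner w w" by (simp add: w inn power2_norm_eq_inner)
    also have "\<dots> = (w $ 1)\<^sup>2 + (w $ 2)\<^sup>2 + (w $ 3)\<^sup>2" by (simp add: inner_vec_def sum_3 power2_eq_square)
    finally show ?thesis
      unfolding f(2)[symmetric] w inn by (simp add: cart_eq_inner_axis inner_commute)
  qed
  moreover have "norm (f (axis i 1)) = 1" for i
    by (simp add: norm_eq_1 inn inner_axis_axis)
  moreover have "inner (f (axis i 1)) (f (axis j 1)) = 0" if "i \<noteq> j" for i j
    using that by (simp add: inn inner_axis_axis)
  ultimately show thesis
    by (intro that[of "f (axis 1 1)" "f (axis 2 1)"]) (simp_all add: f(2)[symmetric])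
qed

theorem open_polygon_length_ge:
  fixes z :: "nat \<Rightarrow> real^3"
  assumes all: "\<And>p. norm p = 1 \<Longrightarrow> \<exists>i\<le>n. 1 < inner p (z i)"
  shows "sqrt ((pi + 2)\<^sup>2 + 36) \<le> (\<Sum>k<n. norm (z (Suc k) - z k))"
proof -
  obtain p i j k l where p: "norm p = 1" "i < j" "j < k" "k < l" "l \<le> n"
    "1 < inner p (z i)" "inner p (z j) < -1" "1 < inner p (z k)" "inner p (z l) < -1"
    using direction_path_alternates[OF all] .
  obtain e1 e2 where e: "norm e1 = 1" "norm e2 = 1" "inner e1 e2 = 0"
    "\<And>v. (norm v)\<^sup>2 = (inner e1 v)\<^sup>2 + (inner e2 v)\<^sup>2 + (inner p v)\<^sup>2"
    using orthonormal_completion_3[OF p(1)] by metis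
  define h where "h m = inner p (z m)" for m
  define y where "y m = Complex (inner e1 (z m)) (inner e2 (z m))" for m
  \<comment> \<open>Three swings between heights above 1 and below -1, each longer than 2; the
    repeated \<open>l\<close> makes the fourth chord zero.\<close>
  have "6 \<le> (\<Sum>m<n. norm (h (Suc m) - h m))"
    using sum_norm_subpath_le[of i j k l l n h] p(2-) by (simp add: h_def)
  moreover have "pi + 2 \<le> (\<Sum>m<n. norm (y (Suc m) - y m))"
  proof (rule planar_path_length_ge)
    fix x :: real
    define v where "v = cos x *\<^sub>R e1 + sin x *\<^sub>R e2"
    have "inner v v = 1"
      using e(1-3) by (simp add: v_def inner_add_left inner_add_right inner_commute power2_eq_square[symmetric]
          norm_eq_sqrt_inner)
    then have "norm v = 1" by (simp add: norm_eq_sqrt_inner)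
    then obtain m where "m \<le> n" "1 < inner v (z m)" using all by blast
    then show "\<exists>m\<le>n. 1 \<le> inner (cis x) (y m)"
      by (auto simp: v_def y_def inner_complex_def inner_add_left intro!: exI[of _ m])
  qed
  ultimately have "(pi + 2)\<^sup>2 + 36 \<le> (\<Sum>m<n. norm (y (Suc m) - y m))\<^sup>2 + (\<Sum>m<n. norm (h (Suc m) - h m))\<^sup>2"
    using power_mono[of 6 "\<Sum>m<n. norm (h (Suc m) - h m)" 2]
      power_mono[of "pi + 2" "\<Sum>m<n. norm (y (Suc m) - y m)" 2] by simp
  \<comment> \<open>Minkowski's inequality is the triangle inequality for complex numbers whose
    parts are the projected and the vertical step lengths.\<close>
  also have "sqrt \<dots> = norm (\<Sum>m<n. Complex (norm (y (Suc m) - y m)) (norm (h (Suc m) - h m)))"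
    by (simp add: cmod_def)
  also have "\<dots> \<le> (\<Sum>m<n. norm (Complex (norm (y (Suc m) - y m)) (norm (h (Suc m) - h m))))"
    by (rule norm_sum)
  also have "\<dots> = (\<Sum>m<n. norm (z (Suc m) - z m))"
  proof (rule sum.cong)
    fix m
    have "(norm (Complex (norm (y (Suc m) - y m)) (norm (h (Suc m) - h m))))\<^sup>2 = (norm (z (Suc m) - z m))\<^sup>2"
      unfolding e(4) by (simp add: cmod_power2 y_def h_def inner_diff_right)
    then show "norm (Complex (norm (y (Suc m) - y m)) (norm (h (Suc m) - h m))) = norm (z (Suc m) - z m)"
      by simp
  qed simp
  finally show ?thesis by simp
qed

subsection \<open>Volumes of spherical caps\<close>

text \<open>Cavalieri's principle. \<open>T\<close> matches boxes with boxes of equal volume, hence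
  transports Lebesgue measure from the product space, where Fubini's theorem applies.\<close>

lemma emeasure_lborel_vec3_slices:
  fixes A :: "(real^3) set"
  assumes "A \<in> sets borel"
  shows "emeasure lborel A = (\<integral>\<^sup>+h. emeasure lborel {xy. vector [fst xy, snd xy, h] \<in> A} \<partial>lborel)"
proof -
  define T :: "(real \<times> real) \<times> real \<Rightarrow> real^3" where "T = (\<lambda>(xy, h). vector [fst xy, snd xy, h])"
  have T_nth: "T v $ 1 = fst (fst v)" "T v $ 2 = snd (fst v)" "T v $ 3 = snd v" for v
    by (simp_all add: T_def split_beta vector_3)
  have "continuous_on UNIV (\<lambda>v. T v $ i)" for i
    using exhaust_3[of i] by (elim disjE; simp add: T_nth; intro continuous_intros)
  then have "continuous_on UNIV T" by (intro continuous_on_vec_lambda[of UNIV "\<lambda>i v. T v $ i", simplified])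
  then have [measurable]: "T \<in> borel_measurable borel" by (rule borel_measurable_continuous_onI)
  have T_distr: "lborel = distr lborel borel T"
  proof (rule lborel_eqI)
    fix l u :: "real^3" assume le: "\<And>b. b \<in> Basis \<Longrightarrow> l \<bullet> b \<le> u \<bullet> b"
    have le': "l $ i \<le> u $ i" for i
      using le[of "axis i 1"] by (auto simp: axis_in_Basis_iff inner_axis)
    have vi: "T -` box l u = box ((l$1, l$2), l$3) ((u$1, u$2), u$3)"
      unfolding set_eq_iff vimage_def mem_Collect_eq mem_box_cart forall_3 T_nth
      by (auto simp: mem_box Basis_prod_def)
    have "emeasure (distr lborel borel T) (box l u) = emeasure lborel (T -` box l u)"
      by (simp add: emeasure_distr)
    also have "\<dots> = ennreal (\<Prod>b\<in>Basis. (((u$1, u$2), u$3) - ((l$1, l$2), l$3)) \<bullet> b)"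
      unfolding vi by (rule emeasure_lborel_box) (use le' in \<open>auto simp: Basis_prod_def\<close>)
    also have "(\<Prod>b\<in>Basis. (((u$1, u$2), u$3) - ((l$1, l$2), l$3)) \<bullet> b) = (\<Prod>i\<in>UNIV. u $ i - l $ i)"
    proof -
      have B: "(Basis :: ((real \<times> real) \<times> real) set) = {((1, 0), 0), ((0, 1), 0), ((0, 0), 1)}"
        by (auto simp: Basis_prod_def zero_prod_def)
      show ?thesis unfolding UNIV_3 B by simp
    qed
    also have "\<dots> = (\<Prod>b\<in>Basis. (u - l) \<bullet> b)"
    proof -
      have B: "(Basis :: (real^3) set) = range (\<lambda>i. axis i 1)" by (auto simp: Basis_vec_def)
      have "inj (\<lambda>i::3. axis i (1::real))" by (auto simp: inj_def axis_eq_axis)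
      then show ?thesis unfolding B by (simp add: prod.reindex inner_axis)
    qed
    finally show "emeasure (distr lborel borel T) (box l u) = (\<Prod>b\<in>Basis. (u - l) \<bullet> b)" .
  qed simp
  have "emeasure lborel A = emeasure (lborel :: ((real \<times> real) \<times> real) measure) (T -` A)"
    using assms unfolding T_distr by (subst emeasure_distr) auto
  also have "\<dots> = (\<integral>\<^sup>+h. emeasure lborel ((\<lambda>xy. (xy, h)) -` (T -` A)) \<partial>lborel)"
  proof -
    have "T -` A \<in> sets borel" using measurable_sets[of T borel borel A] assms by simp
    then have "T -` A \<in> sets (lborel \<Otimes>\<^sub>M lborel)" by (metis lborel_prod sets_lborel)
    then show ?thesis
      by (subst lborel_prod[symmetric]) (rule lborel_pair.emeasure_pair_measure_alt2)
  qed
  finally show ?thesis by (simp add: T_def vimage_def)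
qed

text \<open>The volume of a spherical sector from its horizontal slices: below height
  \<open>c\<close> they are discs of a cone, above it discs of the ball.\<close>

lemma nn_integral_zone_slices:
  fixes c :: real
  assumes "0 < c" "c \<le> 1"
  shows "(\<integral>\<^sup>+h. ennreal (pi * (1 - c\<^sup>2) / c\<^sup>2 * h\<^sup>2) * indicator {0..c} h
      + ennreal (pi * (1 - h\<^sup>2)) * indicator {c..1} h \<partial>lborel) = ennreal (2 * pi / 3 * (1 - c))"
proof -
  define K where "K = pi * (1 - c\<^sup>2) / c\<^sup>2"
  have c1: "c\<^sup>2 \<le> 1" "c \<noteq> 0" using assms by (auto simp: power_le_one)
  then have K: "0 \<le> K" by (simp add: K_def)
  have "(\<integral>\<^sup>+h. ennreal (K * h\<^sup>2) * indicator {0..c} h \<partial>lborel) = ennreal (K * c ^ 3 / 3 - K * 0 ^ 3 / 3)"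
    by (rule nn_integral_FTC_Icc[where F = "\<lambda>h. K * h ^ 3 / 3"])
       (use assms K in \<open>auto intro!: derivative_eq_intros\<close>)
  moreover have "(\<integral>\<^sup>+h. ennreal (pi * (1 - h\<^sup>2)) * indicator {c..1} h \<partial>lborel)
      = ennreal (pi * (1 - 1 ^ 3 / 3) - pi * (c - c ^ 3 / 3))"
    by (rule nn_integral_FTC_Icc[where F = "\<lambda>h. pi * (h - h ^ 3 / 3)"])
       (use assms in \<open>auto intro!: derivative_eq_intros simp: power_le_one\<close>)
  moreover have "K * c ^ 3 / 3 + (pi * (1 - 1 / 3) - pi * (c - c ^ 3 / 3)) = 2 * pi / 3 * (1 - c)"
  proof -
    have "K * c ^ 3 = pi * (1 - c\<^sup>2) * c" using c1 by (simp add: K_def power2_eq_square power3_eq_cube)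
    then show ?thesis by (simp add: algebra_simps power2_eq_square power3_eq_cube)
  qed
  moreover have "0 \<le> pi * (1 - 1 / 3) - pi * (c - c ^ 3 / 3)"
  proof -
    have "pi * (c - c ^ 3 / 3) \<le> pi * (1 - 1 ^ 3 / 3)"
      by (rule DERIV_nonneg_imp_nondecreasing[of c 1 "\<lambda>h. pi * (h - h ^ 3 / 3)"])
         (use assms in \<open>auto intro!: derivative_eq_intros exI simp: power_le_one\<close>)
    then show ?thesis by simp
  qed
  ultimately show ?thesis
    using assms K
    by (subst nn_integral_add) (auto simp: K_def[symmetric] ennreal_plus[symmetric] simp del: ennreal_plus)
qed

text \<open>The solid sector over a spherical cap, so that Lebesgue volume, one third of the area,
  replaces surface measure. For a point x, \<open>cap x 1\<close> is the sector over the unit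
  vectors whose tangent plane contains x or has x on its far side.\<close>

definition cap :: "real^3 \<Rightarrow> real \<Rightarrow> (real^3) set" where
  "cap k c = {p \<in> ball 0 1. c * norm p \<le> inner k p}"

definition open_cap :: "real^3 \<Rightarrow> real \<Rightarrow> (real^3) set" where
  "open_cap k c = {p \<in> ball 0 1. c * norm p < inner k p}"

lemma cap_borel [measurable]: "cap k c \<in> sets borel"
  unfolding cap_def by measurable

lemma open_cap_borel [measurable]: "open_cap k c \<in> sets borel"
  unfolding open_cap_def by measurable

lemma lmeasurable_subset_ball:
  assumes "A \<in> sets borel" "A \<subseteq> ball (0 :: 'a::euclidean_space) 1"
  shows "A \<in> lmeasurable"
  using assms by (intro bounded_set_imp_lmeasurable) (auto intro: bounded_subset[OF bounded_ball])

lemma cap_lmeasurable [simp]: "cap k c \<in> lmeasurable"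
  by (rule lmeasurable_subset_ball) (auto simp: cap_def)

lemma open_cap_lmeasurable [simp]: "open_cap k c \<in> lmeasurable"
  by (rule lmeasurable_subset_ball) (auto simp: open_cap_def)

lemma norm_vector_3: "norm (vector [x, y, h] :: real^3) = sqrt (x\<^sup>2 + y\<^sup>2 + h\<^sup>2)"
  by (simp add: norm_eq_sqrt_inner inner_vec_def sum_3 vector_3 power2_eq_square)

lemma mult_sqrt_le_iff: "c * sqrt x \<le> h \<longleftrightarrow> 0 \<le> h \<and> c\<^sup>2 * x \<le> h\<^sup>2" if "0 < c" "0 \<le> x"
proof -
  have "c * sqrt x = sqrt (c\<^sup>2 * x)" using that by (simp add: real_sqrt_mult)
  then show ?thesis using that sqrt_le_D real_le_lsqrt[of h "c\<^sup>2 * x"]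
    by (metis order_trans real_sqrt_ge_zero zero_le_mult_iff zero_le_power2)
qed

text \<open>At height h the closed sector has its slice inside the closed disc of radius
  \<open>r h\<close>, and the open sector has a slice containing the open disc of that radius; both
  discs have area \<open>g h\<close>. The height \<open>c\<close>, where both terms of
  \<open>g\<close> would count, is a null set.\<close>

lemma measure_caps_axis:
  assumes c: "0 < c" "c \<le> 1"
  shows "measure lebesgue (cap (axis 3 1) c) \<le> 2 * pi / 3 * (1 - c)"
    and "2 * pi / 3 * (1 - c) \<le> measure lebesgue (open_cap (axis 3 1) c)"
proof -
  define g where "g h = ennreal (pi * (1 - c\<^sup>2) / c\<^sup>2 * h\<^sup>2) * indicator {0..c} h
      + ennreal (pi * (1 - h\<^sup>2)) * indicator {c..1} h" for h
  define r where "r h = (if h \<le> c then sqrt (1 - c\<^sup>2) / c * h else sqrt (1 - h\<^sup>2))" for h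
  have c2: "c\<^sup>2 \<le> 1" using c by (simp add: power_le_one)
  have disc: "emeasure lborel (ball (0::real \<times> real) (r h)) = g h"
    "emeasure lborel (cball (0::real \<times> real) (r h)) = g h" if "0 \<le> h" "h \<le> 1" "h \<noteq> c" for h
  proof -
    have r0: "0 \<le> r h" using that c c2 by (auto simp: r_def power_le_one)
    have "ennreal (unit_ball_vol 2 * r h ^ 2) = g h"
      using that c c2 by (auto simp: r_def g_def unit_ball_vol_2 power_divide power_mult_distrib power_le_one)
    then show "emeasure lborel (ball (0::real \<times> real) (r h)) = g h"
      "emeasure lborel (cball (0::real \<times> real) (r h)) = g h"
      using emeasure_ball[OF r0, of "0::real \<times> real"] emeasure_cball[OF r0, of "0::real \<times> real"]
      by (simp_all add: power2_eq_square)
  qed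
  have r2: "(r h)\<^sup>2 = (if h \<le> c then h\<^sup>2 / c\<^sup>2 - h\<^sup>2 else 1 - h\<^sup>2)" if "0 \<le> h" "h \<le> 1" for h
    using that c c2 by (auto simp: r_def power_mult_distrib power_divide power_le_one field_simps)
  have closed_slice: "{xy. vector [fst xy, snd xy, h] \<in> cap (axis 3 1) c} \<subseteq> cball 0 (r h)"
    if h: "0 \<le> h" "h \<le> 1" for h
  proof
    fix xy :: "real \<times> real" assume xy: "xy \<in> {xy. vector [fst xy, snd xy, h] \<in> cap (axis 3 1) c}"
    define s where "s = (fst xy)\<^sup>2 + (snd xy)\<^sup>2"
    have "s + h\<^sup>2 < 1" and *: "c * sqrt (s + h\<^sup>2) \<le> h"
      using xy by (auto simp: cap_def norm_vector_3 inner_axis' vector_3 s_def)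
    moreover have "c\<^sup>2 * (s + h\<^sup>2) \<le> h\<^sup>2"
      using * c by (subst (asm) mult_sqrt_le_iff) (auto simp: s_def)
    then have "s + h\<^sup>2 \<le> h\<^sup>2 / c\<^sup>2" using c by (simp add: pos_le_divide_eq mult.commute)
    ultimately have "s \<le> (r h)\<^sup>2" using r2[OF h] by auto
    moreover have "0 \<le> r h" using h c c2 by (auto simp: r_def power_le_one)
    ultimately have "norm xy \<le> r h"
      by (simp add: norm_prod_def s_def real_le_lsqrt)
    then show "xy \<in> cball 0 (r h)" by simp
  qed
  have open_slice: "ball 0 (r h) \<subseteq> {xy. vector [fst xy, snd xy, h] \<in> open_cap (axis 3 1) c}"
    if h: "0 \<le> h" "h \<le> 1" "h \<noteq> c" for h
  proof
    fix xy :: "real \<times> real" assume "xy \<in> ball 0 (r h)"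
    define s where "s = (fst xy)\<^sup>2 + (snd xy)\<^sup>2"
    have "norm xy < r h" using \<open>xy \<in> ball 0 (r h)\<close> by simp
    then have "(norm xy)\<^sup>2 < (r h)\<^sup>2" by (intro power_strict_mono) auto
    then have s: "s < (r h)\<^sup>2" by (simp add: norm_prod_def s_def)
    have "s + h\<^sup>2 < 1 \<and> s + h\<^sup>2 < h\<^sup>2 / c\<^sup>2"
    proof (cases "h \<le> c")
      case True
      then have "h\<^sup>2 / c\<^sup>2 < 1" using h c by (simp add: power_strict_mono)
      then show ?thesis using s r2[OF h(1,2)] True by simp
    next
      case False
      then have "1 < h\<^sup>2 / c\<^sup>2" using h c by (simp add: power_strict_mono)
      then show ?thesis using s r2[OF h(1,2)] False by simp
    qed
    then have "s + h\<^sup>2 < 1" and lt: "c\<^sup>2 * (s + h\<^sup>2) < h\<^sup>2"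
      using c by (auto simp: pos_less_divide_eq mult.commute)
    moreover have "c * sqrt (s + h\<^sup>2) < h"
    proof -
      have "c * sqrt (s + h\<^sup>2) = sqrt (c\<^sup>2 * (s + h\<^sup>2))" using c by (simp add: real_sqrt_mult)
      also have "\<dots> < sqrt (h\<^sup>2)" using lt by (rule real_sqrt_less_mono)
      finally show ?thesis using h by simp
    qed
    ultimately show "xy \<in> {xy. vector [fst xy, snd xy, h] \<in> open_cap (axis 3 1) c}"
      by (simp add: open_cap_def norm_vector_3 inner_axis' vector_3 s_def)
  qed
  have empty: "{xy. vector [fst xy, snd xy, h] \<in> cap (axis 3 1) c} = {}" if "\<not> (0 \<le> h \<and> h \<le> 1)" for h
  proof -
    have False if "vector [x, y, h] \<in> cap (axis 3 1) c" for x y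
    proof -
      have "norm (vector [x, y, h] :: real^3) < 1" "c * norm (vector [x, y, h] :: real^3) \<le> h"
        using that by (auto simp: cap_def inner_axis' vector_3)
      moreover have "0 \<le> c * norm (vector [x, y, h] :: real^3)" using c by simp
      moreover have "\<bar>h\<bar> \<le> norm (vector [x, y, h] :: real^3)"
        using component_le_norm_cart[of "vector [x, y, h] :: real^3" 3] by (simp add: vector_3)
      ultimately show False using \<open>\<not> (0 \<le> h \<and> h \<le> 1)\<close> by linarith
    qed
    then show ?thesis by auto
  qed
  have g_out: "g h = 0" if "\<not> (0 \<le> h \<and> h \<le> 1)" for h using that c by (auto simp: g_def indicator_def)
  have AEc: "AE h in lborel. h \<noteq> c" by (rule AE_lborel_singleton)
  have int_g: "(\<integral>\<^sup>+h. g h \<partial>lborel) = ennreal (2 * pi / 3 * (1 - c))"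
    unfolding g_def by (rule nn_integral_zone_slices[OF c])
  have "emeasure lborel (cap (axis 3 1) c) \<le> (\<integral>\<^sup>+h. g h \<partial>lborel)"
    unfolding emeasure_lborel_vec3_slices[OF cap_borel]
  proof (rule nn_integral_mono_AE, use AEc in eventually_elim)
    fix h assume "h \<noteq> c"
    then show "emeasure lborel {xy. vector [fst xy, snd xy, h] \<in> cap (axis 3 1) c} \<le> g h"
      using emeasure_mono[OF closed_slice[of h], of lborel] disc(2)[of h] empty[of h]
      by (cases "0 \<le> h \<and> h \<le> 1") auto
  qed
  then show "measure lebesgue (cap (axis 3 1) c) \<le> 2 * pi / 3 * (1 - c)"
    using c enn2real_leI[of "2 * pi / 3 * (1 - c)" "emeasure lborel (cap (axis 3 1) c)"]
    unfolding int_g by (simp only: measure_completion sets_lborel cap_borel measure_def) simp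
  have "(\<integral>\<^sup>+h. g h \<partial>lborel) \<le> emeasure lborel (open_cap (axis 3 1) c)"
    unfolding emeasure_lborel_vec3_slices[OF open_cap_borel]
  proof (rule nn_integral_mono_AE, use AEc in eventually_elim)
    fix h assume hc: "h \<noteq> c"
    have "{xy. vector [fst xy, snd xy, h] \<in> open_cap (axis 3 1) c} \<in> sets (borel :: (real \<times> real) measure)"
    proof -
      have "continuous_on UNIV (\<lambda>xy::real \<times> real. (vector [fst xy, snd xy, h] :: real^3) $ i)" for i
        using exhaust_3[of i] by (elim disjE; simp add: vector_3; intro continuous_intros)
      then have "continuous_on UNIV (\<lambda>xy::real \<times> real. vector [fst xy, snd xy, h] :: real^3)"
        by (intro continuous_on_vec_lambda[of UNIV "\<lambda>i xy. (vector [fst xy, snd xy, h] :: real^3) $ i", simplified])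
      then have "(\<lambda>xy::real \<times> real. vector [fst xy, snd xy, h] :: real^3) \<in> borel_measurable borel"
        by (rule borel_measurable_continuous_onI)
      from measurable_sets[OF this open_cap_borel[of "axis 3 1" c]] show ?thesis by (simp add: vimage_def)
    qed
    then show "g h \<le> emeasure lborel {xy. vector [fst xy, snd xy, h] \<in> open_cap (axis 3 1) c}"
      using emeasure_mono[OF open_slice[of h], of lborel] disc(1)[of h] g_out[of h] hc
      by (cases "0 \<le> h \<and> h \<le> 1") auto
  qed
  moreover have "emeasure lborel (open_cap (axis 3 1) c) = ennreal (measure lebesgue (open_cap (axis 3 1) c))"
    using emeasure_eq_measure2[OF open_cap_lmeasurable[of "axis 3 1" c]] by (simp add: emeasure_completion)
  ultimately show "2 * pi / 3 * (1 - c) \<le> measure lebesgue (open_cap (axis 3 1) c)"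
    unfolding int_g by (simp add: ennreal_le_iff)
qed

lemma orthogonal_image_cap:
  assumes "orthogonal_transformation f"
  shows "f ` cap k c = cap (f k) c"
proof -
  have i: "inner (f x) (f y) = inner x y" and n: "norm (f x) = norm x" for x y
    using assms by (auto simp: orthogonal_transformation_def orthogonal_transformation_norm)
  have "f x \<in> cap (f k) c \<longleftrightarrow> x \<in> cap k c" for x by (simp add: cap_def i n)
  moreover have "surj f" using assms orthogonal_transformation_surj by blast
  ultimately show ?thesis by (metis (no_types, lifting) image_subset_iff subsetI subset_antisym surjE imageI)
qed

lemma orthogonal_image_open_cap:
  assumes "orthogonal_transformation f"
  shows "f ` open_cap k c = open_cap (f k) c"
proof -
  have i: "inner (f x) (f y) = inner x y" and n: "norm (f x) = norm x" for x y
    using assms by (auto simp: orthogonal_transformation_def orthogonal_transformation_norm)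
  have "f x \<in> open_cap (f k) c \<longleftrightarrow> x \<in> open_cap k c" for x by (simp add: open_cap_def i n)
  moreover have "surj f" using assms orthogonal_transformation_surj by blast
  ultimately show ?thesis by (metis (no_types, lifting) image_subset_iff subsetI subset_antisym surjE imageI)
qed

lemma open_cap_subset_cap: "open_cap k c \<subseteq> cap k c"
  by (auto simp: open_cap_def cap_def)

lemma measure_cap:
  assumes k: "norm k = 1" and c: "0 < c" "c \<le> 1"
  shows "measure lebesgue (cap k c) = 2 * pi / 3 * (1 - c)"
    and "measure lebesgue (open_cap k c) = 2 * pi / 3 * (1 - c)"
proof -
  have "norm (axis 3 1 :: real^3) = 1" by (simp add: norm_eq_1 inner_axis_axis)
  from orthogonal_transformation_exists_1[OF this k]
  obtain f where f: "orthogonal_transformation f" "f (axis 3 1 :: real^3) = k" .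
  have "measure lebesgue (cap k c) = measure lebesgue (cap (axis 3 1) c)"
    using measure_orthogonal_image[OF f(1) cap_lmeasurable] orthogonal_image_cap[OF f(1)] f(2) by metis
  moreover have "measure lebesgue (open_cap k c) = measure lebesgue (open_cap (axis 3 1) c)"
    using measure_orthogonal_image[OF f(1) open_cap_lmeasurable] orthogonal_image_open_cap[OF f(1)] f(2) by metis
  moreover have "measure lebesgue (open_cap k c) \<le> measure lebesgue (cap k c)"
    by (rule measure_mono_fmeasurable) (auto simp: open_cap_subset_cap fmeasurableD)
  ultimately show "measure lebesgue (cap k c) = 2 * pi / 3 * (1 - c)"
    "measure lebesgue (open_cap k c) = 2 * pi / 3 * (1 - c)"
    using measure_caps_axis[OF c] by linarith+
qed

text \<open>The band is what two disjoint opposite open sectors leave of the ball, so this is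
  Archimedes' formula: 4 pi / 3 minus 4 pi / 3 times (1 - s).\<close>

lemma measure_band_le:
  assumes k: "norm k = 1" and s: "0 < s" "s \<le> 1"
  shows "measure lebesgue {p \<in> ball (0::real^3) 1. \<bar>inner k p\<bar> \<le> s * norm p} \<le> 4 * pi / 3 * s"
proof -
  define B where "B = ball (0::real^3) 1"
  have sub: "{p \<in> B. \<bar>inner k p\<bar> \<le> s * norm p} = B - (open_cap k s \<union> open_cap (-k) s)"
    by (auto simp: open_cap_def B_def abs_le_iff not_less)
  have disj: "open_cap k s \<inter> open_cap (-k) s = {}"
  proof -
    have False if "s * norm p < inner k p" "s * norm p < - inner k p" for p
    proof -
      have "0 \<le> s * norm p" using s by simp
      then show False using that by linarith
    qed
    then show ?thesis by (fastforce simp: open_cap_def)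
  qed
  have "measure lebesgue (open_cap k s \<union> open_cap (-k) s) = 4 * pi / 3 * (1 - s)"
    using measure_cap(2)[OF k s] measure_cap(2)[of "-k" s] k s disj
    by (subst measure_Un2) (auto simp: fmeasurableD Diff_triv Int_commute)
  moreover have "measure lebesgue B = 4 * pi / 3"
    using sphere_volume[of 1 "0::real^3"] by (simp add: B_def measure_completion)
  moreover have "measure lebesgue (B - (open_cap k s \<union> open_cap (-k) s))
      = measure lebesgue B - measure lebesgue (open_cap k s \<union> open_cap (-k) s)"
    by (rule measurable_measure_Diff) (auto simp: B_def open_cap_def fmeasurableD fmeasurable.Un)
  ultimately show ?thesis unfolding B_def[symmetric] sub by (simp add: algebra_simps)
qed

lemma measure_sym_diff_triangle:
  assumes "A \<in> lmeasurable" "B \<in> lmeasurable" "C \<in> lmeasurable"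
  shows "measure lebesgue (sym_diff A C) \<le> measure lebesgue (sym_diff A B) + measure lebesgue (sym_diff B C)"
proof -
  have "measure lebesgue (sym_diff A C) \<le> measure lebesgue (sym_diff A B \<union> sym_diff B C)"
    using assms by (intro measure_mono_fmeasurable fmeasurable.Un fmeasurable.Diff) (auto simp: fmeasurableD)
  also have "\<dots> \<le> measure lebesgue (sym_diff A B) + measure lebesgue (sym_diff B C)"
    using assms by (intro measure_Un_le) (auto simp: fmeasurableD)
  finally show ?thesis .
qed

lemma measure_sym_diff_subset:
  assumes "A \<in> lmeasurable" "B \<in> lmeasurable" "A \<subseteq> B"
  shows "measure lebesgue (sym_diff A B) = measure lebesgue B - measure lebesgue A"
proof -
  have "sym_diff A B = B - A" using assms by auto
  then show ?thesis using assms by (simp add: measurable_measure_Diff fmeasurableD)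
qed

text \<open>For nonnegative \<open>q\<close> the angles with cosine at least \<open>q\<close> form
  one arc of the right half circle, which can be left only once within a full turn. A shift brings
  \<open>x0\<close> into that half circle; \<open>x2\<close> then lies in it or in its next
  copy.\<close>

lemma cos_superlevel_interval:
  assumes "0 \<le> q" "q \<le> cos x0" "cos x1 < q" "q \<le> cos x2" "cos x3 < q"
    and ord: "x0 \<le> x1" "x1 \<le> x2" "x2 \<le> x3" "x3 \<le> x0 + 2 * pi"
  shows False
proof -
  define m where "m = \<lfloor>(x0 + pi) / (2 * pi)\<rfloor>"
  define y where "y x = x - 2 * pi * of_int m" for x
  have m: "of_int m \<le> (x0 + pi) / (2 * pi)" "(x0 + pi) / (2 * pi) < of_int m + 1"
    unfolding m_def by linarith+
  then have y0: "- pi \<le> y x0" "y x0 < pi" by (simp_all add: y_def field_simps)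
  have cy: "cos (y x) = cos x" for x
    unfolding y_def cos_diff cos_int_2pin sin_int_2pin by simp
  have yb: "\<bar>y x0\<bar> \<le> pi / 2"
  proof (rule ccontr)
    assume "\<not> ?thesis"
    then have "cos \<bar>y x0\<bar> < cos (pi/2)" using y0 by (intro cos_monotone_0_pi) auto
    then show False using assms(1,2) cy by simp
  qed
  then have yb2: "- (pi/2) \<le> y x0" "y x0 \<le> pi/2" by linarith+
  have mid: "q \<le> cos v" if "q \<le> cos u" "q \<le> cos w" "u \<le> v" "v \<le> w" "- (pi/2) \<le> u" "w \<le> pi/2" for u v w
  proof -
    have "\<bar>v\<bar> \<le> max \<bar>u\<bar> \<bar>w\<bar>" "max \<bar>u\<bar> \<bar>w\<bar> \<le> pi" using that by auto
    then have "cos (max \<bar>u\<bar> \<bar>w\<bar>) \<le> cos \<bar>v\<bar>" by (intro cos_monotone_0_pi_le) auto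
    moreover have "q \<le> cos (max \<bar>u\<bar> \<bar>w\<bar>)" using that by (auto simp: max_def)
    ultimately show ?thesis by simp
  qed
  have ord': "y x0 \<le> y x1" "y x1 \<le> y x2" "y x2 \<le> y x3" "y x3 \<le> y x0 + 2 * pi" using ord by (simp_all add: y_def)
  have p: "cos (t - 2 * pi) = cos t" for t :: real by (simp add: cos_diff)
  consider "y x2 \<le> pi/2" | "3 * pi / 2 \<le> y x2" | "pi/2 < y x2" "y x2 < 3 * pi / 2" by linarith
  then show False
  proof cases
    case 1
    have "q \<le> cos (y x1)" by (rule mid[of "y x0" "y x2"]) (use 1 assms ord' yb2 cy in auto)
    then show False using assms(3) cy by simp
  next
    case 2
    have "q \<le> cos (y x3 - 2 * pi)"
      by (rule mid[of "y x2 - 2 * pi" "y x0"]) (use 2 assms ord' yb2 cy p in auto)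
    then show False using assms(5) cy p by simp
  next
    case 3
    then have "\<bar>y x2 - pi\<bar> < pi/2" unfolding abs_less_iff by linarith
    then have "cos \<bar>y x2 - pi\<bar> > cos (pi/2)" by (intro cos_monotone_0_pi) auto
    then have "cos (y x2) < 0" by (simp add: cos_diff)
    then show False using assms(1,4) cy by simp
  qed
qed

section \<open>Sectors with centres on a great circle\<close>

locale frame =
  fixes e1 e2 e3 :: "real^3"
  assumes norm_e: "norm e1 = 1" "norm e2 = 1" "norm e3 = 1"
    and orth: "inner e1 e2 = 0" "inner e1 e3 = 0" "inner e2 e3 = 0"
    and norm2: "(norm v)\<^sup>2 = (inner e1 v)\<^sup>2 + (inner e2 v)\<^sup>2 + (inner e3 v)\<^sup>2"
begin

definition dir :: "real \<Rightarrow> real^3" where "dir x = cos x *\<^sub>R e1 + sin x *\<^sub>R e2"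

lemma inner_e: "inner e1 e1 = 1" "inner e2 e2 = 1" "inner e3 e3 = 1"
  "inner e2 e1 = 0" "inner e3 e1 = 0" "inner e3 e2 = 0"
  using norm_e orth by (simp_all add: norm_eq_1 inner_commute)

lemma inner_dir: "inner (dir x) v = cos x * inner e1 v + sin x * inner e2 v"
  by (simp add: dir_def inner_add_left)

lemma inner_e_dir: "inner e1 (dir x) = cos x" "inner e2 (dir x) = sin x" "inner e3 (dir x) = 0"
  by (simp_all add: dir_def inner_add_right inner_e orth)

lemma norm_dir: "norm (dir x) = 1"
proof -
  have "(norm (dir x))\<^sup>2 = 1" unfolding norm2[of "dir x"] by (simp add: inner_e_dir)
  then show ?thesis by (simp add: power2_eq_1_iff) (metis norm_ge_zero not_one_le_zero neg_0_le_iff_le)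
qed

definition rot :: "real \<Rightarrow> real^3 \<Rightarrow> real^3" where
  "rot t v = inner e1 v *\<^sub>R dir t + inner e2 v *\<^sub>R dir (t + pi/2) + inner e3 v *\<^sub>R e3"

lemma rot_dir: "rot t (dir x) = dir (x + t)"
  unfolding rot_def inner_e_dir unfolding dir_def by (simp add: cos_add sin_add algebra_simps)

lemma orthogonal_transformation_rot: "orthogonal_transformation (rot t)"
  unfolding orthogonal_transformation
proof
  show "linear (rot t)"
    by (rule linearI) (simp_all add: rot_def inner_add_right algebra_simps)
  show "\<forall>v. norm (rot t v) = norm v"
  proof
    fix v
    have "(norm (rot t v))\<^sup>2 = (norm v)\<^sup>2"
    proof -
      have r: "inner e1 (rot t v) = inner e1 v * cos t - inner e2 v * sin t"
        "inner e2 (rot t v) = inner e1 v * sin t + inner e2 v * cos t" "inner e3 (rot t v) = inner e3 v"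
        by (simp_all add: rot_def inner_add_right inner_e_dir orth inner_e cos_add sin_add)
      have "(norm (rot t v))\<^sup>2 = ((inner e1 v)\<^sup>2 + (inner e2 v)\<^sup>2) * ((sin t)\<^sup>2 + (cos t)\<^sup>2) + (inner e3 v)\<^sup>2"
        unfolding norm2[of "rot t v"] r by algebra
      then show ?thesis unfolding norm2[of v] by simp
    qed
    then show "norm (rot t v) = norm v" by simp
  qed
qed

text \<open>The sets of points that the sector leaves during \<open>N\<close> successive rotations
  by \<open>b\<close> are congruent. They are pairwise disjoint because the rotations stay within a
  full turn, and all lie in the band swept by the sector, so each has at most 1/N of its
  volume.\<close>

lemma measure_cap_exit_le:
  assumes c: "0 < c" "c < 1" and b: "0 < b" "real N * b \<le> 2 * pi" "0 < N"
  shows "measure lebesgue (cap (dir x) c - cap (dir (x + b)) c) \<le> 4 * pi / 3 * sqrt (1 - c\<^sup>2) / real N"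
proof -
  define X where "X j = cap (dir (x + real j * b)) c - cap (dir (x + real (Suc j) * b)) c" for j
  have Xm: "X j \<in> lmeasurable" for j by (auto simp: X_def intro!: fmeasurable.Diff)
  have "X j = rot (real j * b) ` X 0" for j
  proof -
    have "inj (rot (real j * b))"
      using orthogonal_transformation_rot orthogonal_transformation_inj by blast
    then show ?thesis
      by (simp add: X_def image_set_diff orthogonal_image_cap[OF orthogonal_transformation_rot] rot_dir algebra_simps)
  qed
  then have mX: "measure lebesgue (X j) = measure lebesgue (X 0)" for j
    using measure_orthogonal_image[OF orthogonal_transformation_rot Xm[of 0]] by metis
  have disj: "disjoint_family_on X {..<N}"
  proof -
    have False if jk: "j < k" "k < N" and p: "p \<in> X j" "p \<in> X k" for j k p
    proof -
      \<comment> \<open>For fixed \<open>p\<close> the inner product with the centre at angle v is r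
        cos (v - t). Membership in two exit sets would mean leaving one superlevel arc twice within
        a turn.\<close>
      obtain r t where rt: "inner e1 p = r * cos t" "inner e2 p = r * sin t" "0 \<le> r"
        using rcis_cmod_Arg[of "Complex (inner e1 p) (inner e2 p)"] by (metis complex.sel norm_ge_zero Re_rcis Im_rcis)
      have ip: "inner (dir v) p = r * cos (v - t)" for v
        by (simp add: inner_dir rt cos_diff algebra_simps)
      have "p \<noteq> 0" using p by (auto simp: X_def cap_def)
      then have pos: "0 < c * norm p" using c by simp
      have in_cap: "c * norm p \<le> inner (dir (x + real i * b)) p \<and> inner (dir (x + real (Suc i) * b)) p < c * norm p"
        if "p \<in> X i" for i using that by (auto simp: X_def cap_def)
      have "r \<noteq> 0" using in_cap[OF p(1)] pos by (auto simp: ip)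
      with rt have r: "0 < r" by simp
      define q where "q = c * norm p / r"
      have q: "0 \<le> q" using pos r by (simp add: q_def)
      have ge: "q \<le> cos (x + real i * b - t)" and lt: "cos (x + real (Suc i) * b - t) < q" if "p \<in> X i" for i
        using in_cap[OF that] r unfolding ip q_def by (simp_all add: field_simps)
      show False
      proof (rule cos_superlevel_interval[OF q ge[OF p(1)] lt[OF p(1)] ge[OF p(2)] lt[OF p(2)]])
        have "real (Suc j) * b \<le> real k * b" using jk b by (intro mult_right_mono) auto
        then show "x + real (Suc j) * b - t \<le> x + real k * b - t" by simp
        have "real (Suc k) * b \<le> real N * b" using jk b by (intro mult_right_mono) auto
        moreover have "0 \<le> real j * b" using b by simp
        ultimately show "x + real (Suc k) * b - t \<le> x + real j * b - t + 2 * pi" using b by linarith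
      qed (use b in \<open>simp_all add: algebra_simps\<close>)
    qed
    then show ?thesis unfolding disjoint_family_on_def by (metis disjoint_iff linorder_neqE_nat lessThan_iff)
  qed
  have "real N * measure lebesgue (X 0) = (\<Sum>j<N. measure lebesgue (X 0))" by simp
  also have "\<dots> = (\<Sum>j<N. measure lebesgue (X j))" by (intro sum.cong refl mX[symmetric])
  also have "\<dots> = measure lebesgue (\<Union>j<N. X j)"
    using disj fmeasurableD[OF Xm] fmeasurableD2[OF Xm] by (intro measure_finite_Union[symmetric]) auto
  also have "\<dots> \<le> measure lebesgue {p \<in> ball (0::real^3) 1. \<bar>inner e3 p\<bar> \<le> sqrt (1 - c\<^sup>2) * norm p}"
  proof (rule measure_mono_fmeasurable)
    show "(\<Union>j<N. X j) \<subseteq> {p \<in> ball 0 1. \<bar>inner e3 p\<bar> \<le> sqrt (1 - c\<^sup>2) * norm p}"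
    proof
      fix p assume "p \<in> (\<Union>j<N. X j)"
      then obtain v where "p \<in> cap (dir v) c" by (auto simp: X_def)
      then have p: "p \<in> ball 0 1" "c * norm p \<le> cos v * inner e1 p + sin v * inner e2 p"
        by (auto simp: cap_def inner_dir)
      have "(c * norm p)\<^sup>2 \<le> (cos v * inner e1 p + sin v * inner e2 p)\<^sup>2"
        using p c by (intro power_mono) auto
      also have "\<dots> \<le> (cos v * inner e1 p + sin v * inner e2 p)\<^sup>2 + (sin v * inner e1 p - cos v * inner e2 p)\<^sup>2" by simp
      also have "\<dots> = ((sin v)\<^sup>2 + (cos v)\<^sup>2) * ((inner e1 p)\<^sup>2 + (inner e2 p)\<^sup>2)" by algebra
      also have "\<dots> = (norm p)\<^sup>2 - (inner e3 p)\<^sup>2" unfolding norm2[of p] by simp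
      finally have "(inner e3 p)\<^sup>2 \<le> (1 - c\<^sup>2) * (norm p)\<^sup>2" by (simp add: power_mult_distrib algebra_simps)
      then have "sqrt ((inner e3 p)\<^sup>2) \<le> sqrt ((1 - c\<^sup>2) * (norm p)\<^sup>2)" by (rule real_sqrt_le_mono)
      then show "p \<in> {p \<in> ball 0 1. \<bar>inner e3 p\<bar> \<le> sqrt (1 - c\<^sup>2) * norm p}"
        using p by (simp add: real_sqrt_mult)
    qed
    show "(\<Union>j<N. X j) \<in> sets lebesgue" using Xm by (auto simp: fmeasurableD)
    show "{p \<in> ball (0::real^3) 1. \<bar>inner e3 p\<bar> \<le> sqrt (1 - c\<^sup>2) * norm p} \<in> lmeasurable"
      by (rule lmeasurable_subset_ball) auto
  qed
  also have "\<dots> \<le> 4 * pi / 3 * sqrt (1 - c\<^sup>2)"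
    using c by (intro measure_band_le norm_e) (auto simp: abs_square_less_1)
  finally show ?thesis using b by (simp add: X_def field_simps)
qed

text \<open>Both differences have the same volume because the sectors do, and each is bounded
  through 1/N for N the integer part of 2 pi / b. The bound b / (2 pi - b) for 1/N behaves like b /
  (2 pi) for small b, which gives the right derivative later.\<close>

lemma measure_sym_diff_rotated_caps_le:
  assumes c: "0 < c" "c < 1" and b: "0 \<le> b" "b < 2 * pi"
  shows "measure lebesgue (sym_diff (cap (dir x) c) (cap (dir (x + b)) c))
      \<le> 8 * pi / 3 * sqrt (1 - c\<^sup>2) * (b / (2 * pi - b))"
proof (cases "b = 0")
  case False
  then have b0: "0 < b" using b by simp
  define N where "N = nat \<lfloor>2 * pi / b\<rfloor>"
  have "1 \<le> 2 * pi / b" using b b0 by simp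
  then have N: "0 < N" "real N \<le> 2 * pi / b" "2 * pi / b < real N + 1"
    unfolding N_def by linarith+
  define A B where "A = cap (dir x) c" and "B = cap (dir (x + b)) c"
  have AB: "A \<in> lmeasurable" "B \<in> lmeasurable" by (simp_all add: A_def B_def)
  have "measure lebesgue A = measure lebesgue B"
    using c by (simp add: A_def B_def measure_cap(1) norm_dir del: measure_completion)
  moreover have "measure lebesgue (A - B) = measure lebesgue A - measure lebesgue (A \<inter> B)"
    "measure lebesgue (B - A) = measure lebesgue B - measure lebesgue (A \<inter> B)"
    using measurable_measure_Diff[of A lebesgue "A \<inter> B"] measurable_measure_Diff[of B lebesgue "A \<inter> B"] AB
    by (simp_all add: Diff_Int_distrib Diff_Int fmeasurableD)
  moreover have "measure lebesgue (sym_diff A B) \<le> measure lebesgue (A - B) + measure lebesgue (B - A)"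
    using AB by (intro measure_Un_le) (auto simp: fmeasurableD)
  moreover have "measure lebesgue (A - B) \<le> 4 * pi / 3 * sqrt (1 - c\<^sup>2) / real N"
    unfolding A_def B_def using N b0 c by (intro measure_cap_exit_le) (auto simp: field_simps)
  ultimately have "measure lebesgue (sym_diff A B) \<le> 8 * pi / 3 * sqrt (1 - c\<^sup>2) * (1 / real N)" by simp
  also have "\<dots> \<le> 8 * pi / 3 * sqrt (1 - c\<^sup>2) * (b / (2 * pi - b))"
  proof (intro mult_left_mono)
    have "2 * pi - b \<le> real N * b" using N(3) b0 by (simp add: field_simps)
    then show "1 / real N \<le> b / (2 * pi - b)" using N(1) b by (simp add: field_simps)
    show "0 \<le> 8 * pi / 3 * sqrt (1 - c\<^sup>2)" using c by (simp add: power_le_one)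
  qed
  finally show ?thesis by (simp add: A_def B_def)
qed (use b in simp)

lemma cap_subset_cap:
  assumes "\<bar>x - y\<bar> \<le> s - r" "0 < r" "s < pi/2"
  shows "cap (dir x) (cos r) \<subseteq> cap (dir y) (cos s)"
proof
  fix p assume "p \<in> cap (dir x) (cos r)"
  then have p: "p \<in> ball 0 1" "cos r * norm p \<le> inner (dir x) p" by (auto simp: cap_def)
  define \<sigma> :: real where "\<sigma> = (if x \<le> y then 1 else -1)"
  define b where "b = \<bar>x - y\<bar>"
  have \<sigma>: "\<sigma> * \<sigma> = 1" "cos (\<sigma> * v) = cos v" "sin (\<sigma> * v) = \<sigma> * sin v" for v by (auto simp: \<sigma>_def)
  have y: "y = x + \<sigma> * b" by (auto simp: \<sigma>_def b_def)
  have b: "0 \<le> b" "b + r \<le> s" using assms by (auto simp: b_def)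
  have pos: "0 < sin r" "0 \<le> sin b" "0 \<le> sin (b + r)"
    using assms b by (auto intro!: sin_gt_zero sin_ge_zero)
  text \<open>The centre \<open>dir x\<close> is a positive combination of \<open>dir y\<close> and the boundary point
    of the smaller cap opposite to \<open>y\<close>.\<close>
  have comb: "sin (b + r) * inner (dir x) p = sin r * inner (dir y) p + sin b * inner (dir (x - \<sigma> * r)) p"
  proof -
    have A: "sin r * cos (x + \<sigma> * b) + sin b * cos (x - \<sigma> * r) = sin (b + r) * cos x"
      unfolding cos_add cos_diff sin_add \<sigma> by (simp add: algebra_simps)
    have B: "sin r * sin (x + \<sigma> * b) + sin b * sin (x - \<sigma> * r) = sin (b + r) * sin x"
      unfolding sin_add sin_diff \<sigma> by (simp add: algebra_simps)
    have "sin (b + r) * inner (dir x) p = (sin (b + r) * cos x) * inner e1 p + (sin (b + r) * sin x) * inner e2 p"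
      by (simp add: inner_dir algebra_simps)
    then show ?thesis
      unfolding A[symmetric] B[symmetric] by (simp add: inner_dir y algebra_simps)
  qed
  have "inner (dir (x - \<sigma> * r)) p \<le> norm p"
    using norm_cauchy_schwarz[of "dir (x - \<sigma> * r)" p] by (simp add: norm_dir)
  then have "sin b * inner (dir (x - \<sigma> * r)) p \<le> sin b * norm p" using pos by (intro mult_left_mono)
  moreover have "sin (b + r) * (cos r * norm p) \<le> sin (b + r) * inner (dir x) p"
    using p pos by (intro mult_left_mono)
  ultimately have "(sin (b + r) * cos r - sin b) * norm p \<le> sin r * inner (dir y) p"
    using comb by (simp add: algebra_simps)
  also have "sin (b + r) * cos r - sin b = sin r * cos (b + r)"
    using sin_diff[of "b + r" r] by simp
  finally have "sin r * (cos (b + r) * norm p) \<le> sin r * inner (dir y) p" by (simp add: mult.assoc)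
  then have "cos (b + r) * norm p \<le> inner (dir y) p" using pos by simp
  moreover have "cos s * norm p \<le> cos (b + r) * norm p"
    using assms b by (intro mult_right_mono cos_monotone_0_pi_le) auto
  ultimately show "p \<in> cap (dir y) (cos s)" using p by (simp add: cap_def)
qed

text \<open>The first sector is turned by \<open>b\<close>, just until one sector contains the
  other, namely until the angle between the centres is at most the difference of the radii. From
  there on only the difference of the volumes counts.\<close>

lemma measure_sym_diff_caps_le:
  assumes r: "0 < r" "r < pi/2" and s: "0 < s" "s < pi/2"
    and b: "b = max 0 (\<bar>x - y\<bar> - \<bar>r - s\<bar>)" "b < 2 * pi"
  shows "measure lebesgue (sym_diff (cap (dir x) (cos r)) (cap (dir y) (cos s)))
      \<le> 8 * pi / 3 * sin r * (b / (2 * pi - b)) + 2 * pi / 3 * \<bar>cos r - cos s\<bar>"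
proof -
  define w where "w = (if x \<le> y then x + b else x - b)"
  have w: "\<bar>w - y\<bar> \<le> \<bar>r - s\<bar>" using b by (auto simp: w_def)
  have cr: "0 < cos r" "cos r < 1" "0 < cos s" "cos s < 1"
    using r s cos_monotone_0_pi[of 0 r] cos_monotone_0_pi[of 0 s] by (auto intro!: cos_gt_zero)
  have md: "measure lebesgue (cap (dir u) c) - measure lebesgue (cap (dir v) d) \<le> 2 * pi / 3 * \<bar>d - c\<bar>"
    if "0 < c" "c < 1" "0 < d" "d < 1" for c d u v
  proof -
    have "measure lebesgue (cap (dir u) c) - measure lebesgue (cap (dir v) d) = 2 * pi / 3 * (d - c)"
      using that by (simp add: measure_cap(1) norm_dir right_diff_distrib del: measure_completion)
    also have "\<dots> \<le> 2 * pi / 3 * \<bar>d - c\<bar>" by (intro mult_left_mono) auto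
    finally show ?thesis .
  qed
  have sr: "sqrt (1 - (cos r)\<^sup>2) = sin r"
    using r by (simp add: sin_squared_eq[symmetric] sin_ge_zero)
  have b0: "0 \<le> b" using b by simp
  have "measure lebesgue (sym_diff (cap (dir x) (cos r)) (cap (dir w) (cos r)))
      \<le> 8 * pi / 3 * sin r * (b / (2 * pi - b))"
  proof (cases "x \<le> y")
    case True
    then show ?thesis
      using measure_sym_diff_rotated_caps_le[OF cr(1,2) b0 b(2), of x] by (simp add: w_def sr)
  next
    case False
    then show ?thesis
      using measure_sym_diff_rotated_caps_le[OF cr(1,2) b0 b(2), of "x - b"] by (simp add: w_def sr Un_commute)
  qed
  moreover have "measure lebesgue (sym_diff (cap (dir w) (cos r)) (cap (dir y) (cos s))) \<le> 2 * pi / 3 * \<bar>cos r - cos s\<bar>"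
  proof (cases "r \<le> s")
    case True
    then have "cap (dir w) (cos r) \<subseteq> cap (dir y) (cos s)" using w r s by (intro cap_subset_cap) auto
    then show ?thesis
      using md[OF cr(3,4,1,2), of y w] by (simp add: measure_sym_diff_subset del: measure_completion)
  next
    case False
    then have "cap (dir y) (cos s) \<subseteq> cap (dir w) (cos r)" using w r s by (intro cap_subset_cap) auto
    then have "measure lebesgue (sym_diff (cap (dir y) (cos s)) (cap (dir w) (cos r))) \<le> 2 * pi / 3 * \<bar>cos r - cos s\<bar>"
      using md[OF cr(1,2,3,4), of w y] by (simp add: measure_sym_diff_subset abs_minus_commute del: measure_completion)
    then show ?thesis by (simp add: Un_commute)
  qed
  ultimately show ?thesis
    using measure_sym_diff_triangle[of "cap (dir x) (cos r)" "cap (dir w) (cos r)" "cap (dir y) (cos s)"] by simp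
qed

end

subsection \<open>Tangent planes separating the end points of a segment\<close>

text \<open>In terms of y, the square of t, the maximum of y^2 (1 - y) is 4/27, attained at the
  double root y = 2/3 of the difference. This maximum is the source of the constant
  \<open>6 * sqrt 3\<close>.\<close>

lemma sq_mult_sqrt_one_minus_sq_le:
  fixes t :: real
  assumes "0 \<le> t" "t \<le> 1"
  shows "t\<^sup>2 * sqrt (1 - t\<^sup>2) \<le> 2 / (3 * sqrt 3)"
proof (rule power2_le_imp_le)
  define y where "y = t\<^sup>2"
  have y: "0 \<le> y" "y \<le> 1" using assms by (auto simp: y_def power_le_one)
  have "4/27 - y\<^sup>2 * (1 - y) = (y - 2/3)\<^sup>2 * (y + 1/3)"
    by (simp add: power2_eq_square field_simps)
  moreover have "0 \<le> (y - 2/3)\<^sup>2 * (y + 1/3)" using y by simp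
  ultimately have "y\<^sup>2 * (1 - y) \<le> 4 / 27" by linarith
  then show "(t\<^sup>2 * sqrt (1 - t\<^sup>2))\<^sup>2 \<le> (2 / (3 * sqrt 3))\<^sup>2"
    using y by (simp add: y_def power_mult_distrib power_divide)
qed simp

text \<open>The extremal case is \<open>x = t\<close>, where the edge lies on a tangent line of the unit sphere.\<close>

lemma crossing_density_le:
  fixes t x :: real
  assumes t: "0 < t" "t \<le> x" "x \<le> 1"
  shows "4 * t * (x * sqrt (1 - t\<^sup>2) + (pi/2 - 1) * t * sqrt (1 - x\<^sup>2)) \<le> 4 * pi / (3 * sqrt 3)"
proof -
  define w v k where "w = sqrt (1 - t\<^sup>2)" and "v = sqrt (1 - x\<^sup>2)" and "k = pi/2 - 1"
  have t1: "t \<le> 1" "t\<^sup>2 \<le> 1" "x\<^sup>2 \<le> 1" using t by (auto simp: power_le_one)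
  have w: "0 \<le> w" "w\<^sup>2 = 1 - t\<^sup>2" and v: "0 \<le> v" "v\<^sup>2 = 1 - x\<^sup>2" using t1 by (simp_all add: w_def v_def)
  have k: "0 \<le> k" "k + 1 = pi/2" using pi_approx by (simp_all add: k_def)
  have "4 * t * (x * w + k * t * v) \<le> 4 * pi / (3 * sqrt 3)"
  proof (cases "1 \<le> (k + 1) * t\<^sup>2")
    case True
    \<comment> \<open>For large \<open>t\<close> the extremum is at \<open>x = t\<close>: after
      multiplication by \<open>w\<close> and with \<open>w * v \<le> 1 - x * t\<close>, the left
      side is bounded by an affine function of \<open>x\<close> with nonpositive slope.\<close>
    have "x * w + k * t * v \<le> (k + 1) * t * w"
    proof (cases "w = 0")
      case True
      then have "t\<^sup>2 = 1" using w by simp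
      then have "t = 1" using t by (simp add: power2_eq_1_iff)
      then have "x = 1" using t by simp
      then have "v = 0" by (simp add: v_def)
      then show ?thesis using True by simp
    next
      case False
      then have w0: "0 < w" using w by simp
      have "(w * v)\<^sup>2 \<le> (1 - x * t)\<^sup>2"
      proof -
        have "(1 - x * t)\<^sup>2 - (w * v)\<^sup>2 = (x - t)\<^sup>2"
          unfolding power_mult_distrib w v by (simp add: power2_eq_square algebra_simps)
        then show ?thesis using zero_le_power2[of "x - t"] by linarith
      qed
      moreover have "x * t \<le> 1" using t by (simp add: mult_le_one)
      ultimately have wv: "w * v \<le> 1 - x * t" by (intro power2_le_imp_le[of "w * v" "1 - x * t"]) auto
      have "w * (x * w + k * t * v) = x * w\<^sup>2 + k * t * (w * v)" by (simp add: power2_eq_square algebra_simps)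
      also have "\<dots> \<le> x * (1 - t\<^sup>2) + k * t * (1 - x * t)"
        unfolding w using wv k t by (intro add_left_mono mult_left_mono) auto
      also have "\<dots> = x * (1 - (k + 1) * t\<^sup>2) + k * t" by (simp add: power2_eq_square algebra_simps)
      also have "\<dots> \<le> t * (1 - (k + 1) * t\<^sup>2) + k * t"
        using t True by (intro add_right_mono mult_right_mono_neg) auto
      also have "\<dots> = w * ((k + 1) * t * w)"
      proof -
        have "w * ((k + 1) * t * w) = (k + 1) * t * w\<^sup>2" by (simp add: power2_eq_square)
        then show ?thesis unfolding w by (simp add: power2_eq_square algebra_simps)
      qed
      finally show ?thesis using w0 by simp
    qed
    then have "4 * t * (x * w + k * t * v) \<le> 4 * t * ((k + 1) * t * w)" using t by (intro mult_left_mono) auto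
    also have "\<dots> = 2 * pi * (t\<^sup>2 * w)" by (simp add: k power2_eq_square)
    also have "\<dots> \<le> 2 * pi * (2 / (3 * sqrt 3))"
      using sq_mult_sqrt_one_minus_sq_le[of t] t t1 by (intro mult_left_mono) (auto simp: w_def)
    finally show ?thesis by simp
  next
    case False
    \<comment> \<open>For small \<open>t\<close> the Cauchy-Schwarz inequality removes
      \<open>x\<close> and leaves y (1 - q y), which is at most its value at y = 2/pi, the border of
      this case.\<close>
    define y q where "y = t\<^sup>2" and "q = 1 - k\<^sup>2"
    have "pi/2 * t\<^sup>2 < 1" using False unfolding k(2) by simp
    then have y: "0 \<le> y" "y \<le> 2/pi" by (auto simp: y_def field_simps)
    have q: "q = pi - pi\<^sup>2/4" by (simp add: q_def k_def power2_eq_square algebra_simps)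
    have "(x * w + k * t * v)\<^sup>2 \<le> (x\<^sup>2 + v\<^sup>2) * (w\<^sup>2 + (k * t)\<^sup>2)"
    proof -
      have "(x\<^sup>2 + v\<^sup>2) * (w\<^sup>2 + (k * t)\<^sup>2) - (x * w + k * t * v)\<^sup>2 = (x * (k * t) - v * w)\<^sup>2" by algebra
      then show ?thesis using zero_le_power2[of "x * (k * t) - v * w"] by linarith
    qed
    also have "\<dots> = 1 - q * y" unfolding v w by (simp add: y_def q_def algebra_simps power2_eq_square)
    finally have "y * (x * w + k * t * v)\<^sup>2 \<le> y * (1 - q * y)" using y by (intro mult_left_mono) auto
    also have "\<dots> \<le> 2/pi * (1 - q * (2/pi))"
    proof -
      have "q * (2/pi + y) \<le> q * (2/pi + 2/pi)"
      proof (intro mult_left_mono)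
        have "pi * pi \<le> pi * 4" by (intro mult_left_mono) (use pi_approx in auto)
        then show "0 \<le> q" by (simp add: q power2_eq_square)
      qed (use y in simp)
      also have "\<dots> = 4 - pi" by (simp add: q power2_eq_square field_simps)
      finally have "0 \<le> (2/pi - y) * (1 - q * (2/pi + y))" using y pi_approx by (intro mult_nonneg_nonneg) auto
      moreover have "(Y - y) * (1 - q * (Y + y)) = Y * (1 - q * Y) - y * (1 - q * y)" for Y
        by (simp add: algebra_simps)
      ultimately show ?thesis by simp
    qed
    also have "\<dots> = 1 - 2/pi" by (simp add: q power2_eq_square field_simps)
    \<comment> \<open>Equivalent to 27 (pi - 2) \<le> pi^3, true by a narrow margin: about 30.8
      against 31.0.\<close>
    also have "\<dots> \<le> pi\<^sup>2 / 27"
    proof -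
      have "3.14 * 3.14 * 3.14 \<le> pi * pi * pi" using pi_approx by (intro mult_mono) auto
      then have "27 * (pi - 2) \<le> pi * pi * pi" using pi_approx by simp
      then show ?thesis by (simp add: field_simps power2_eq_square)
    qed
    finally have "(4 * t * (x * w + k * t * v))\<^sup>2 \<le> 16 * (pi\<^sup>2 / 27)" by (simp add: power_mult_distrib y_def)
    also have "\<dots> = (4 * pi / (3 * sqrt 3))\<^sup>2" by (simp add: power_mult_distrib power_divide)
    finally show ?thesis by (rule power2_le_imp_le) simp
  qed
  then show ?thesis by (simp add: w_def v_def k_def)
qed

lemma cap_scaleR:
  assumes "0 < r"
  shows "cap (r *\<^sub>R k) 1 = cap k (1 / r)"
  using assms by (auto simp: cap_def field_simps)

lemma tendsto_abs_difference_quotient: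
  fixes f :: "real \<Rightarrow> real"
  assumes "DERIV f x :> D"
  shows "((\<lambda>s. \<bar>f s - f x\<bar> / \<bar>s - x\<bar>) \<longlongrightarrow> \<bar>D\<bar>) (at x)"
  using tendsto_rabs[OF assms[unfolded has_field_derivative_iff]] by (simp add: abs_divide)

context frame
begin

definition line :: "real \<Rightarrow> real \<Rightarrow> real^3" where "line d s = d *\<^sub>R e1 + s *\<^sub>R e2"

lemma line_polar:
  assumes "0 < d"
  shows "line d s = sqrt (d\<^sup>2 + s\<^sup>2) *\<^sub>R dir (arctan (s / d))"
proof -
  have "sqrt (1 + (s / d)\<^sup>2) = sqrt (d\<^sup>2 + s\<^sup>2) / d"
  proof -
    have "1 + (s / d)\<^sup>2 = (d\<^sup>2 + s\<^sup>2) / d\<^sup>2" using assms by (simp add: field_simps power_divide)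
    then show ?thesis using assms by (simp add: real_sqrt_divide)
  qed
  moreover have "0 < sqrt (d\<^sup>2 + s\<^sup>2)" using assms by (simp add: add_pos_nonneg)
  ultimately show ?thesis
    using assms by (simp add: line_def dir_def cos_arctan sin_arctan scaleR_add_right)
qed

text \<open>One third of the measure of the tangent planes that separate two points of a line; a
  pseudometric in the two parameters.\<close>

definition sep :: "real \<Rightarrow> real \<Rightarrow> real \<Rightarrow> real" where
  "sep d s t = measure lebesgue (sym_diff (cap (line d s) 1) (cap (line d t) 1))"

lemma sep_triangle: "sep d r t \<le> sep d r s + sep d s t"
  unfolding sep_def by (rule measure_sym_diff_triangle) simp_all

lemma sep_commute: "sep d s t = sep d t s"
  by (simp add: sep_def Un_commute)

text \<open>The sector of \<open>line d s\<close> has centre angle \<open>\<xi> s\<close> and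
  angular radius \<open>\<psi> s\<close>, whose cosine \<open>\<kappa> s\<close> is the inverse
  distance from the origin. Dividing the bound of \<open>measure_sym_diff_caps_le\<close> by
  \<open>\<bar>s - x\<bar>\<close> gives the limit \<Lambda>, which
  \<open>crossing_density_le\<close> controls. The constant is a third of 4 pi / (3 sqrt 3) because
  the sectors are solid.\<close>

lemma sep_local:
  assumes d: "1 < d" and e: "0 < e"
  shows "\<exists>\<delta>>0. \<forall>s. \<bar>s - x\<bar> < \<delta> \<longrightarrow> sep d x s \<le> (4 * pi / (9 * sqrt 3) + e) * \<bar>s - x\<bar>"
proof -
  define \<rho> \<kappa> \<xi> \<psi> where "\<rho> s = sqrt (d\<^sup>2 + s\<^sup>2)" and "\<kappa> s = 1 / sqrt (d\<^sup>2 + s\<^sup>2)"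
    and "\<xi> s = arctan (s / d)" and "\<psi> s = arccos (1 / sqrt (d\<^sup>2 + s\<^sup>2))" for s
  have d2: "1 < d\<^sup>2" using d by (simp add: power2_eq_square less_1_mult)
  have d2s: "1 < d\<^sup>2 + s\<^sup>2" for s using d2 zero_le_power2[of s] by linarith
  have \<rho>: "1 < \<rho> s" "(\<rho> s)\<^sup>2 = d\<^sup>2 + s\<^sup>2" for s
    using d2s[of s] by (simp_all add: \<rho>_def)
  have \<kappa>: "\<kappa> s = 1 / \<rho> s" "0 < \<kappa> s" "\<kappa> s < 1" for s using \<rho>(1)[of s] by (simp_all add: \<kappa>_def \<rho>_def)
  have \<psi>: "0 < \<psi> s" "\<psi> s < pi/2" "cos (\<psi> s) = \<kappa> s" "sin (\<psi> s) = sqrt (1 - (\<kappa> s)\<^sup>2)" for s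
  proof -
    have eq: "\<psi> s = arccos (\<kappa> s)" by (simp add: \<psi>_def \<kappa>_def)
    have m1: "-1 \<le> \<kappa> s" using \<kappa>(2)[of s] by linarith
    show "0 < \<psi> s" "\<psi> s < pi/2" "cos (\<psi> s) = \<kappa> s" "sin (\<psi> s) = sqrt (1 - (\<kappa> s)\<^sup>2)"
      using arccos_less_arccos[of "\<kappa> s" 1] arccos_less_arccos[of 0 "\<kappa> s"] m1 \<kappa>(2,3)[of s]
      unfolding eq by (simp_all add: sin_arccos)
  qed
  have cap_line: "cap (line d s) 1 = cap (dir (\<xi> s)) (cos (\<psi> s))" for s
  proof -
    have "line d s = \<rho> s *\<^sub>R dir (\<xi> s)" using line_polar[of d s] d by (simp add: \<rho>_def \<xi>_def)
    then show ?thesis using cap_scaleR[of "\<rho> s" "dir (\<xi> s)"] \<rho>(1)[of s] \<psi>(3)[of s] \<kappa>(1)[of s] by simp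
  qed
  \<comment> \<open>The cosines of the angular radius and of the centre angle at \<open>x\<close>;
    they are the two arguments for \<open>crossing_density_le\<close>.\<close>
  define t X where "t = \<kappa> x" and "X = d / \<rho> x"
  have t: "0 < t" "t < 1" "t \<le> X" "X \<le> 1"
  proof -
    show "0 < t" "t < 1" using \<kappa> by (simp_all add: t_def)
    show "t \<le> X" using d \<rho>(1)[of x] by (simp add: t_def X_def \<kappa>(1) divide_right_mono)
    have "d\<^sup>2 \<le> (\<rho> x)\<^sup>2" unfolding \<rho>(2) by simp
    then have "d \<le> \<rho> x" by (rule power2_le_imp_le) (use \<rho>(1)[of x] in linarith)
    then show "X \<le> 1" using \<rho>(1)[of x] by (simp add: X_def)
  qed
  have x_\<rho>: "\<bar>x\<bar> / \<rho> x = sqrt (1 - X\<^sup>2)"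
  proof -
    have "X\<^sup>2 + (x / \<rho> x)\<^sup>2 = (\<rho> x)\<^sup>2 / (\<rho> x)\<^sup>2"
      unfolding X_def power_divide add_divide_distrib[symmetric] \<rho>(2) ..
    then have "1 - X\<^sup>2 = (x / \<rho> x)\<^sup>2" using \<rho>(1)[of x] by simp
    then show ?thesis using \<rho>(1)[of x] by (simp add: abs_divide)
  qed
  have D\<xi>: "DERIV \<xi> x :> t * X"
  proof -
    have "DERIV \<xi> x :> inverse (1 + (x / d)\<^sup>2) * (1 / d)"
      unfolding \<xi>_def using d by (auto intro!: derivative_eq_intros)
    moreover have "inverse (1 + (x / d)\<^sup>2) * (1 / d) = t * X"
    proof -
      have "1 + (x / d)\<^sup>2 = (\<rho> x)\<^sup>2 / d\<^sup>2" using d unfolding \<rho>(2) by (simp add: field_simps)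
      then show ?thesis using d \<rho>(1)[of x] by (simp add: t_def X_def \<kappa>(1) power2_eq_square)
    qed
    ultimately show ?thesis by simp
  qed
  define K where "K = - x / (\<rho> x) ^ 3"
  have D\<kappa>: "DERIV \<kappa> x :> K"
  proof -
    have p: "d\<^sup>2 + x\<^sup>2 > 0" using d2s[of x] by linarith
    have "DERIV \<kappa> x :> - (inverse (sqrt (d\<^sup>2 + x\<^sup>2)) / 2 * (2 * x)) / (sqrt (d\<^sup>2 + x\<^sup>2))\<^sup>2"
      unfolding \<kappa>_def using p by (auto intro!: derivative_eq_intros simp: power2_eq_square)
    moreover have "- (inverse (\<rho> x) / 2 * (2 * x)) / (\<rho> x)\<^sup>2 = K"
      using \<rho>(1)[of x] by (simp add: K_def divide_simps power2_eq_square power3_eq_cube)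
    ultimately show ?thesis unfolding \<rho>_def by simp
  qed
  have K: "\<bar>K\<bar> = t\<^sup>2 * sqrt (1 - X\<^sup>2)"
    using \<rho>(1)[of x] unfolding x_\<rho>[symmetric]
    by (simp add: K_def t_def \<kappa>(1) abs_divide power2_eq_square power3_eq_cube)
  define S where "S = sqrt (1 - t\<^sup>2)"
  have S: "0 < S" using t by (simp add: S_def abs_square_less_1)
  have \<psi>_fun: "\<psi> = (\<lambda>s. arccos (\<kappa> s))" by (simp add: fun_eq_iff \<psi>_def \<kappa>_def)
  have D\<psi>: "DERIV \<psi> x :> - K / S"
  proof -
    have "DERIV arccos (\<kappa> x) :> inverse (- sqrt (1 - (\<kappa> x)\<^sup>2))" by (rule DERIV_arccos) (use \<kappa>(2,3)[of x] in linarith)+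
    from DERIV_chain2[OF this D\<kappa>] show ?thesis
      unfolding \<psi>_fun by (simp add: S_def t_def field_simps)
  qed
  define B where "B s = max 0 (\<bar>\<xi> s - \<xi> x\<bar> - \<bar>\<psi> s - \<psi> x\<bar>)" for s
  have B_lim: "((\<lambda>s. B s / \<bar>s - x\<bar>) \<longlongrightarrow> max 0 (t * X - \<bar>K\<bar> / S)) (at x)"
  proof -
    have "((\<lambda>s. max 0 (\<bar>\<xi> s - \<xi> x\<bar> / \<bar>s - x\<bar> - \<bar>\<psi> s - \<psi> x\<bar> / \<bar>s - x\<bar>)) \<longlongrightarrow> max 0 (\<bar>t * X\<bar> - \<bar>- K / S\<bar>)) (at x)"
      by (intro tendsto_intros tendsto_abs_difference_quotient D\<xi> D\<psi>)
    moreover have "\<bar>t * X\<bar> = t * X" "\<bar>- K / S\<bar> = \<bar>K\<bar> / S" using t S by (simp_all add: abs_divide)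
    moreover have "max 0 (\<bar>\<xi> s - \<xi> x\<bar> / \<bar>s - x\<bar> - \<bar>\<psi> s - \<psi> x\<bar> / \<bar>s - x\<bar>) = B s / \<bar>s - x\<bar>" for s
      by (auto simp: B_def max_def diff_divide_distrib[symmetric] divide_le_0_iff zero_le_divide_iff)
    ultimately show ?thesis by (simp only:)
  qed
  have "isCont \<xi> x" "isCont \<psi> x" using D\<xi> D\<psi> DERIV_isCont by blast+
  then have "((\<lambda>s. B s) \<longlongrightarrow> max 0 (\<bar>\<xi> x - \<xi> x\<bar> - \<bar>\<psi> x - \<psi> x\<bar>)) (at x)"
    unfolding B_def isCont_def by (intro tendsto_intros)
  then have B0: "(B \<longlongrightarrow> 0) (at x)" by simp
  define h where "h s = 8 * pi / 3 * S * (B s / (2 * pi - B s)) + 2 * pi / 3 * \<bar>\<kappa> s - \<kappa> x\<bar>" for s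
  define \<Lambda> where "\<Lambda> = 8 * pi / 3 * S * (max 0 (t * X - \<bar>K\<bar> / S) / (2 * pi - 0)) + 2 * pi / 3 * \<bar>K\<bar>"
  have "((\<lambda>s. 8 * pi / 3 * S * ((B s / \<bar>s - x\<bar>) / (2 * pi - B s)) + 2 * pi / 3 * (\<bar>\<kappa> s - \<kappa> x\<bar> / \<bar>s - x\<bar>)) \<longlongrightarrow> \<Lambda>) (at x)"
    unfolding \<Lambda>_def by (intro tendsto_intros B_lim B0 tendsto_abs_difference_quotient D\<kappa>) auto
  moreover have "8 * pi / 3 * S * ((B s / \<bar>s - x\<bar>) / (2 * pi - B s)) + 2 * pi / 3 * (\<bar>\<kappa> s - \<kappa> x\<bar> / \<bar>s - x\<bar>) = h s / \<bar>s - x\<bar>" for s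
    by (simp add: h_def add_divide_distrib)
  ultimately have h_lim: "((\<lambda>s. h s / \<bar>s - x\<bar>) \<longlongrightarrow> \<Lambda>) (at x)" by simp
  \<comment> \<open>If the centre turns at least as fast as the radius changes, both terms of
    \<Lambda> count; otherwise only the volume term remains.\<close>
  have "\<Lambda> \<le> 4 * pi / (9 * sqrt 3)"
  proof (cases "0 \<le> t * X - \<bar>K\<bar> / S")
    case True
    have "S * (t * X - \<bar>K\<bar> / S) = S * t * X - \<bar>K\<bar>" using S by (simp add: right_diff_distrib)
    then have "\<Lambda> = 4/3 * (S * t * X - \<bar>K\<bar>) + 2 * pi / 3 * \<bar>K\<bar>" using True by (simp add: \<Lambda>_def max_def)
    also have "\<dots> = (4 * t * (X * S + (pi/2 - 1) * t * sqrt (1 - X\<^sup>2))) / 3"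
      unfolding K by (simp add: power2_eq_square algebra_simps)
    also have "\<dots> \<le> (4 * pi / (3 * sqrt 3)) / 3"
      using crossing_density_le[of t X] t by (simp add: S_def)
    finally show ?thesis by simp
  next
    case False
    then have "\<Lambda> = 2 * pi / 3 * (t\<^sup>2 * sqrt (1 - X\<^sup>2))" unfolding \<Lambda>_def K[symmetric] by (simp add: max_def)
    also have "\<dots> \<le> 2 * pi / 3 * (t\<^sup>2 * sqrt (1 - t\<^sup>2))"
      using t by (intro mult_left_mono) (auto intro!: power_mono)
    also have "\<dots> \<le> 2 * pi / 3 * (2 / (3 * sqrt 3))"
      using sq_mult_sqrt_one_minus_sq_le[of t] t by (intro mult_left_mono) auto
    finally show ?thesis by simp
  qed
  then have "\<Lambda> < 4 * pi / (9 * sqrt 3) + e" using e by simp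
  then have "\<forall>\<^sub>F s in at x. h s / \<bar>s - x\<bar> < 4 * pi / (9 * sqrt 3) + e"
    using h_lim order_tendstoD(2) by blast
  moreover have "\<forall>\<^sub>F s in at x. B s < 2 * pi" using B0 by (intro order_tendstoD(2)) auto
  ultimately have "\<forall>\<^sub>F s in at x. sep d x s \<le> (4 * pi / (9 * sqrt 3) + e) * \<bar>s - x\<bar>"
    using eventually_neq_at_within[of x]
  proof eventually_elim
    case (elim s)
    have "sep d x s \<le> h s"
      using measure_sym_diff_caps_le[OF \<psi>(1,2) \<psi>(1,2), of "B s" "\<xi> x" "\<xi> s" x s] elim(2)
      by (simp add: sep_def cap_line h_def B_def \<psi>(3,4) S_def t_def abs_minus_commute del: measure_completion)
    moreover have "h s \<le> (4 * pi / (9 * sqrt 3) + e) * \<bar>s - x\<bar>"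
      using elim(1,3) by (simp add: field_simps less_imp_le)
    ultimately show ?case by simp
  qed
  then obtain \<delta> where "\<delta> > 0" "\<And>s. s \<noteq> x \<Longrightarrow> \<bar>s - x\<bar> < \<delta> \<Longrightarrow> sep d x s \<le> (4 * pi / (9 * sqrt 3) + e) * \<bar>s - x\<bar>"
    unfolding eventually_at by (auto simp: dist_real_def)
  then show ?thesis
    by (intro exI[of _ \<delta>]) (metis abs_zero cancel_comm_monoid_add_class.diff_cancel mult_zero_right order_refl sep_def Diff_cancel Un_absorb measure_empty)
qed

text \<open>By the triangle inequality the local bounds chain to a global one through Bolzano's
  bisection principle. The slack e / (t - s + 1) per unit length adds up to at most
  \<open>e\<close>.\<close>

lemma sep_le:
  assumes d: "1 < d" and st: "s \<le> t"
  shows "sep d s t \<le> 4 * pi / (9 * sqrt 3) * (t - s)"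
proof (rule field_le_epsilon)
  fix e :: real assume e: "0 < e"
  define c where "c = 4 * pi / (9 * sqrt 3) + e / (t - s + 1)"
  have "0 < e / (t - s + 1)" using e st by simp
  note loc = sep_local[OF d this, folded c_def]
  from st have "sep d s t \<le> c * (t - s)"
  proof (induction rule: Bolzano)
    case (trans a b c')
    then show ?case using sep_triangle[of d a c' b] by (simp add: algebra_simps)
  next
    case (local x)
    obtain \<delta> where \<delta>: "\<delta> > 0" "\<And>s. \<bar>s - x\<bar> < \<delta> \<Longrightarrow> sep d x s \<le> c * \<bar>s - x\<bar>" using loc by blast
    have "sep d a b \<le> c * (b - a)" if "a \<le> x" "x \<le> b" "b - a < \<delta>" for a b
      using \<delta>(2)[of a] \<delta>(2)[of b] that sep_triangle[of d a b x] sep_commute[of d x a] by (simp add: algebra_simps)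
    then show ?case using \<delta>(1) by blast
  qed
  also have "\<dots> = 4 * pi / (9 * sqrt 3) * (t - s) + e * ((t - s) / (t - s + 1))" by (simp add: c_def algebra_simps)
  also have "\<dots> \<le> 4 * pi / (9 * sqrt 3) * (t - s) + e * 1"
    using e st by (intro add_left_mono mult_left_mono) auto
  finally show "sep d s t \<le> 4 * pi / (9 * sqrt 3) * (t - s) + e" by simp
qed

end

section \<open>Edges in arbitrary position\<close>

lemma frame_exists:
  fixes a b :: "real^3"
  assumes "norm a = 1" "norm b = 1" "inner a b = 0"
  shows "frame a b (cross3 a b)"
proof
  have "(norm (cross3 a b))\<^sup>2 = 1" using norm_cross_dot[of a b] assms by simp
  then show n: "norm (cross3 a b) = 1" by (simp add: power2_eq_1_iff) (metis norm_ge_zero not_one_le_zero neg_0_le_iff_le)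
  show "inner a (cross3 a b) = 0" "inner b (cross3 a b) = 0" by (simp_all add: dot_cross_self)
  fix v :: "real^3"
  have "cross3 v (cross3 a b) = inner v b *\<^sub>R a - inner v a *\<^sub>R b"
    by (simp add: Lagrange)
  then have "(norm (cross3 v (cross3 a b)))\<^sup>2 = (inner v b)\<^sup>2 + (inner v a)\<^sup>2"
    using assms unfolding power2_norm_eq_inner
    by (simp add: inner_diff_left inner_diff_right norm_eq_1 inner_commute power2_eq_square)
  then show "(norm v)\<^sup>2 = (inner a v)\<^sup>2 + (inner b v)\<^sup>2 + (inner (cross3 a b) v)\<^sup>2"
    using norm_cross_dot[of v "cross3 a b"] n by (simp add: inner_commute)
qed (use assms in auto)

text \<open>For \<open>x\<close> outside the ball, \<open>\<bar>a\<bar>\<close> is at least the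
  length of a tangent from \<open>x\<close>; this serves edges that meet the ball, split at the foot
  of the perpendicular. Inside the ball the sector is null; outside, with r the norm of
  \<open>x\<close>, the claim reduces to 27 (r - 1) \<le> 4 r^2 (r + 1).\<close>

lemma measure_cap_le_leg:
  fixes x :: "real^3"
  assumes "(norm x)\<^sup>2 \<le> 1 + a\<^sup>2"
  shows "measure lebesgue (cap x 1) \<le> 4 * pi / (9 * sqrt 3) * \<bar>a\<bar>"
proof (cases "norm x \<le> 1")
  case True
  have "measure lebesgue (cap x 1) \<le> 0"
  proof (cases "x = 0")
    case True
    then have "cap x 1 \<subseteq> {0}" by (auto simp: cap_def)
    then have "negligible (cap x 1)" by (rule negligible_subset[OF negligible_sing])
    then show ?thesis by (simp add: negligible_imp_measure0 del: measure_completion)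
  next
    case False
    define k where "k = (1 / norm x) *\<^sub>R x"
    have k: "norm k = 1" using False by (simp add: k_def)
    have "cap x 1 \<subseteq> cap k 1"
    proof
      fix v assume v: "v \<in> cap x 1"
      then have "norm v \<le> inner x v" by (simp add: cap_def)
      also have "\<dots> = norm x * inner k v" using False by (simp add: k_def)
      also have "\<dots> \<le> 1 * inner k v"
      proof (rule mult_right_mono[OF True])
        have "0 \<le> norm x * inner k v" using calculation norm_ge_zero[of v] by linarith
        then show "0 \<le> inner k v" using False by (simp add: zero_le_mult_iff)
      qed
      finally show "v \<in> cap k 1" using v by (simp add: cap_def)
    qed
    then have "measure lebesgue (cap x 1) \<le> measure lebesgue (cap k 1)"
      by (intro measure_mono_fmeasurable) (auto simp: fmeasurableD)
    also have "\<dots> = 0" using measure_cap(1)[OF k, of 1] by simp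
    finally show ?thesis .
  qed
  moreover have "0 \<le> 4 * pi / (9 * sqrt 3) * \<bar>a\<bar>" by simp
  ultimately show ?thesis by linarith
next
  case False
  define r where "r = norm x"
  have r: "1 < r" using False by (simp add: r_def)
  define k where "k = (1 / r) *\<^sub>R x"
  have k: "norm k = 1" "x = r *\<^sub>R k" using r by (auto simp: k_def r_def)
  have "measure lebesgue (cap x 1) = 2 * pi / 3 * (1 - 1 / r)"
    unfolding k(2) using r by (subst cap_scaleR) (simp_all add: measure_cap(1)[OF k(1)] del: measure_completion)
  also have "\<dots> \<le> 2 * pi / 3 * (2 / (3 * sqrt 3) * \<bar>a\<bar>)"
  proof (intro mult_left_mono)
    have "((1 - 1 / r))\<^sup>2 \<le> 4 / 27 * (r\<^sup>2 - 1)"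
    proof -
      have "27 * (r - 1) \<le> 4 * r\<^sup>2 * (r + 1)"
      proof -
        \<comment> \<open>The cubic has its minimum for positive r near r = 1.2; splitting off the
          square of r - 5/4 leaves a positive remainder.\<close>
        have "4 * r\<^sup>2 * (r + 1) - 27 * (r - 1) = 4 * (r - 5/4)\<^sup>2 * (r + 7/2) + 41/8 + 7/4 * r"
          by (simp add: power2_eq_square field_simps)
        moreover have "0 \<le> 4 * (r - 5/4)\<^sup>2 * (r + 7/2)" using r by (intro mult_nonneg_nonneg) auto
        ultimately show ?thesis using r by linarith
      qed
      then have "(r - 1) * (27 * (r - 1)) \<le> (r - 1) * (4 * r\<^sup>2 * (r + 1))" using r by (intro mult_left_mono) auto
      then have "27 * (r - 1)\<^sup>2 \<le> 4 * (r\<^sup>2 - 1) * r\<^sup>2" by (simp add: power2_eq_square algebra_simps)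
      moreover have "(1 - 1 / r)\<^sup>2 = (r - 1)\<^sup>2 / r\<^sup>2" using r by (simp add: power_divide[symmetric] diff_divide_distrib)
      ultimately show ?thesis using r by (simp add: divide_le_eq)
    qed
    also have "\<dots> \<le> 4 / 27 * a\<^sup>2" using assms by (simp add: r_def)
    also have "\<dots> = (2 / (3 * sqrt 3) * \<bar>a\<bar>)\<^sup>2" by (simp add: power_mult_distrib power_divide)
    finally show "1 - 1 / r \<le> 2 / (3 * sqrt 3) * \<bar>a\<bar>" by (rule power2_le_imp_le) simp
  qed simp
  also have "\<dots> = 4 * pi / (9 * sqrt 3) * \<bar>a\<bar>" by simp
  finally show ?thesis .
qed

text \<open>For fixed v the function \<open>inner (q + c *\<^sub>R u) v - norm v\<close> is affine
  in c and nonpositive at 0, because \<open>q\<close> is in the ball. If it is nonnegative at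
  \<open>a\<close>, it is nonnegative at \<open>b\<close>.\<close>

lemma cap_subset_if_between:
  assumes "norm q \<le> 1" "0 < a" "a < b"
  shows "cap (q + a *\<^sub>R u) 1 \<subseteq> cap (q + b *\<^sub>R u) 1"
proof
  fix v assume v: "v \<in> cap (q + a *\<^sub>R u) 1"
  have "inner q v \<le> 1 * norm v"
    using norm_cauchy_schwarz[of q v] mult_right_mono[OF assms(1), of "norm v"] by simp
  then have "(b - a) * inner q v \<le> (b - a) * norm v" using assms by (intro mult_left_mono) auto
  moreover have "b * norm v \<le> b * (inner q v + a * inner u v)"
    using v assms by (intro mult_left_mono) (auto simp: cap_def inner_add_left)
  ultimately have "a * norm v \<le> a * (inner q v + b * inner u v)" by (simp add: algebra_simps)
  then show "v \<in> cap (q + b *\<^sub>R u) 1" using v assms by (simp add: cap_def inner_add_left)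
qed

text \<open>If the line through \<open>x\<close> and \<open>y\<close> misses the unit ball, the plane count along the segment is
  bounded by integration; if it meets the ball outside the segment, one end point hides the other;
  and if it meets the ball inside the segment, the two caps are small compared with the length.\<close>

lemma edge_cap_cases:
  fixes x y :: "real^3"
  shows "cap x 1 \<subseteq> cap y 1 \<or> cap y 1 \<subseteq> cap x 1 \<or>
    measure lebesgue (sym_diff (cap x 1) (cap y 1)) \<le> 4 * pi / (9 * sqrt 3) * norm (y - x)"
proof (cases "x = y")
  case False
  define u where "u = (1 / norm (y - x)) *\<^sub>R (y - x)"
  have u: "norm u = 1" "y - x = norm (y - x) *\<^sub>R u" using False by (auto simp: u_def)
  \<comment> \<open>Coordinates on the line through \<open>x\<close> and \<open>y\<close>:
    \<open>q\<close> is the foot of the perpendicular from the origin, so the line meets the closed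
    unit ball iff \<open>norm q \<le> 1\<close>.\<close>
  define a b q where "a = inner u x" and "b = inner u y" and "q = x - a *\<^sub>R u"
  have uu: "inner u u = 1" using u by (simp add: norm_eq_1)
  have ba: "b - a = norm (y - x)"
    using u(2) uu by (metis a_def b_def inner_diff_right inner_scaleR_right mult.right_neutral)
  have x: "x = q + a *\<^sub>R u" by (simp add: q_def)
  have y: "y = q + b *\<^sub>R u" using u(2) ba[symmetric] by (simp add: q_def algebra_simps)
  have qu: "inner u q = 0" by (simp add: q_def inner_diff_right uu a_def)
  have ab: "a < b" using ba False by (metis diff_gt_0_iff_gt right_minus_eq zero_less_norm_iff)
  have nq: "(norm (q + c *\<^sub>R u))\<^sup>2 = (norm q)\<^sup>2 + c\<^sup>2" for c
    using qu uu unfolding power2_norm_eq_inner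
    by (simp add: inner_add_left inner_add_right inner_commute power2_eq_square)
  show ?thesis
  proof (cases "norm q \<le> 1")
    case True
    then have q1: "(norm q)\<^sup>2 \<le> 1" by (simp add: power_le_one)
    consider "0 < a" | "b < 0" | "a \<le> 0" "0 \<le> b" by linarith
    then show ?thesis
    proof cases
      case 1
      then show ?thesis using cap_subset_if_between[OF True 1 ab, of u] x y by simp
    next
      case 2
      then show ?thesis using cap_subset_if_between[OF True, of "-b" "-a" "-u"] x y ab by simp
    next
      case 3
      have "measure lebesgue (sym_diff (cap x 1) (cap y 1)) \<le> measure lebesgue (cap x 1 \<union> cap y 1)"
        by (intro measure_mono_fmeasurable fmeasurable.Un) (auto simp: fmeasurableD)
      also have "\<dots> \<le> measure lebesgue (cap x 1) + measure lebesgue (cap y 1)"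
        by (intro measure_Un_le) (auto simp: fmeasurableD)
      also have "\<dots> \<le> 4 * pi / (9 * sqrt 3) * \<bar>a\<bar> + 4 * pi / (9 * sqrt 3) * \<bar>b\<bar>"
        unfolding x y using q1 by (intro add_mono measure_cap_le_leg) (auto simp: nq)
      also have "\<dots> = 4 * pi / (9 * sqrt 3) * (b - a)"
        unfolding distrib_left[symmetric] using 3 by simp
      finally show ?thesis using ba by simp
    qed
  next
    case False
    define d where "d = norm q"
    define e where "e = (1 / d) *\<^sub>R q"
    have d: "1 < d" using False by (simp add: d_def)
    have e: "norm e = 1" "q = d *\<^sub>R e" using d by (auto simp: e_def d_def)
    have "inner e u = 0" using qu by (simp add: e_def inner_commute)
    then interpret frame e u "cross3 e u" using e u by (intro frame_exists)
    have "sep d a b \<le> 4 * pi / (9 * sqrt 3) * (b - a)" using d ab by (intro sep_le) auto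
    then show ?thesis unfolding sep_def line_def e(2)[symmetric] x[symmetric] y[symmetric] ba by blast
  qed
qed simp

subsection \<open>Closed polygons\<close>

text \<open>One recursion with an arbitrary edge weight serves lengths, side changes, indicators and
  volumes, so that integrating along a polygon only changes \<open>g\<close>.\<close>

fun path_sum :: "('a \<Rightarrow> 'a \<Rightarrow> real) \<Rightarrow> 'a list \<Rightarrow> real" where
  "path_sum g (x # y # xs) = g x y + path_sum g (y # xs)"
| "path_sum g [x] = 0"
| "path_sum g [] = 0"

abbreviation "path_len \<equiv> path_sum (\<lambda>x y. norm (y - x))"

lemma path_sum_append: "path_sum g (xs @ y # ys) = path_sum g (xs @ [y]) + path_sum g (y # ys)"
  by (induction xs rule: path_sum.induct[of "\<lambda>_ xs. path_sum g (xs @ y # ys) = path_sum g (xs @ [y]) + path_sum g (y # ys)"])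
     (cases ys; simp)+

lemma path_sum_mono:
  assumes "\<And>as x y bs. xs = as @ x # y # bs \<Longrightarrow> g x y \<le> h x y"
  shows "path_sum g xs \<le> path_sum h xs"
  using assms
proof (induction xs rule: path_sum.induct[of "\<lambda>_. _"])
  case (1 g' x y xs)
  have "g x y \<le> h x y" using 1(2)[of "[]" x y xs] by simp
  moreover have "path_sum g (y # xs) \<le> path_sum h (y # xs)"
    using 1(2) by (intro 1(1)) (metis append_Cons)
  ultimately show ?case by simp
qed auto

lemma path_sum_nonneg: "(\<And>x y. 0 \<le> g x y) \<Longrightarrow> 0 \<le> path_sum g xs"
  by (induction xs rule: induct_list012) auto

lemma path_sum_snoc: "xs \<noteq> [] \<Longrightarrow> path_sum g (xs @ [x]) = path_sum g xs + g (last xs) x"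
  by (induction xs rule: induct_list012) auto

lemma path_sum_cmult: "path_sum (\<lambda>x y. c * g x y) xs = c * path_sum g xs"
  by (induction g xs rule: path_sum.induct) (auto simp: distrib_left)

abbreviation "flips Q \<equiv> path_sum (\<lambda>x y. of_bool (Q x \<noteq> Q y))"

lemma flips_ge_1: "Q x \<noteq> Q z \<Longrightarrow> 1 \<le> flips Q (x # ys @ [z])"
proof (induction ys arbitrary: x)
  case (Cons y ys)
  then show ?case using path_sum_nonneg[of "\<lambda>x y. of_bool (Q x \<noteq> Q y)" "y # ys @ [z]"] by (cases "Q x = Q y") auto
qed simp

lemma flips_closed_ge_2:
  assumes "x \<in> set (a # xs)" "Q x \<noteq> Q a"
  shows "2 \<le> flips Q (a # xs @ [a])"
proof -
  have "x \<in> set xs" using assms by auto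
  then obtain ys zs where "xs = ys @ x # zs" by (auto simp: in_set_conv_decomp)
  then have "flips Q (a # xs @ [a]) = flips Q (a # ys @ [x]) + flips Q (x # zs @ [a])"
    using path_sum_append[of _ "a # ys" x "zs @ [a]"] by simp
  then show ?thesis using flips_ge_1[of Q a x ys] flips_ge_1[of Q x a zs] assms by simp
qed

definition tour_len :: "(real^3) list \<Rightarrow> real" where "tour_len xs = path_len (xs @ [hd xs])"

lemma tour_len_rotate:
  "tour_len (xs @ ys) = tour_len (ys @ xs)"
proof (cases "xs = [] \<or> ys = []")
  case False
  then obtain x xs' y ys' where "xs = x # xs'" "ys = y # ys'" by (meson neq_Nil_conv)
  then show ?thesis
    using path_sum_append[of "\<lambda>x y. norm (y - x)" xs y "ys' @ [x]"] path_sum_append[of "\<lambda>x y. norm (y - x)" ys x "xs' @ [y]"]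
    by (simp add: tour_len_def)
qed auto

lemma tour_len_delete:
  "tour_len (x # bs) \<le> tour_len (x # y # bs)" "tour_len (y # bs) \<le> tour_len (x # y # bs)"
proof -
  have tri: "norm (c - a) \<le> norm (b - a) + norm (c - b)" for a b c :: "real^3"
    using norm_triangle_ineq[of "b - a" "c - b"] by simp
  show "tour_len (x # bs) \<le> tour_len (x # y # bs)"
    using tri[of "hd (bs @ [x])" x y] by (cases bs) (auto simp: tour_len_def)
  have "path_len (y # bs @ [y]) \<le> path_len (y # bs @ [x]) + norm (y - x)"
    using path_sum_snoc[of "y # bs" "\<lambda>x y. norm (y - x)" x] path_sum_snoc[of "y # bs" "\<lambda>x y. norm (y - x)" y]
      tri[of y "last (y # bs)" x] by simp
  then show "tour_len (y # bs) \<le> tour_len (x # y # bs)"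
    by (simp add: tour_len_def)
qed

definition covers :: "(real^3) list \<Rightarrow> bool" where
  "covers xs \<longleftrightarrow> (\<forall>p. norm p = 1 \<longrightarrow> (\<exists>x\<in>set xs. 1 \<le> inner x p))"

lemma covers_delete:
  assumes "covers xs" "y \<in> set xs" "set xs - {x} \<subseteq> set ys" "y \<in> set ys" "cap x 1 \<subseteq> cap y 1"
  shows "covers ys"
  unfolding covers_def
proof (intro allI impI)
  fix p :: "real^3" assume p: "norm p = 1"
  then obtain w where w: "w \<in> set xs" "1 \<le> inner w p" using assms(1) by (auto simp: covers_def)
  show "\<exists>x\<in>set ys. 1 \<le> inner x p"
  proof (cases "w = x")
    case True
    \<comment> \<open>Sectors lie in the open ball, so the unit vector \<open>p\<close> is tested at
      half its length.\<close>
    then have "(1/2) *\<^sub>R p \<in> cap x 1" using w p by (simp add: cap_def)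
    then have "(1/2) *\<^sub>R p \<in> cap y 1" using assms(5) by blast
    then show ?thesis using p assms(4) by (auto simp: cap_def)
  next
    case False
    then show ?thesis using w assms(3) by blast
  qed
qed

lemma integral_path_sum:
  fixes S :: "'a \<Rightarrow> 'a \<Rightarrow> (real^3) set"
  assumes "\<And>x y. S x y \<in> lmeasurable"
  shows "integrable lebesgue (\<lambda>p. path_sum (\<lambda>x y. indicator (S x y) p) xs)"
    and "(LINT p|lebesgue. path_sum (\<lambda>x y. indicator (S x y) p) xs) = path_sum (\<lambda>x y. measure lebesgue (S x y)) xs"
proof -
  have i: "integrable lebesgue (indicat_real (S x y))" for x y
    using assms[of x y] by (intro integrable_real_indicator) (auto simp: fmeasurable_def)
  have "integrable lebesgue (\<lambda>p. path_sum (\<lambda>x y. indicator (S x y) p) xs) \<and>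
    (LINT p|lebesgue. path_sum (\<lambda>x y. indicator (S x y) p) xs) = path_sum (\<lambda>x y. measure lebesgue (S x y)) xs"
    by (induction "\<lambda>x y. measure lebesgue (S x y)" xs rule: path_sum.induct)
       (use i in \<open>simp_all add: Bochner_Integration.integral_add del: measure_completion\<close>)
  then show "integrable lebesgue (\<lambda>p. path_sum (\<lambda>x y. indicator (S x y) p) xs)"
    "(LINT p|lebesgue. path_sum (\<lambda>x y. indicator (S x y) p) xs) = path_sum (\<lambda>x y. measure lebesgue (S x y)) xs" by auto
qed

theorem closed_polygon_length_ge:
  assumes "covers xs"
  shows "6 * sqrt 3 \<le> tour_len xs"
proof -
  define P where "P ys \<longleftrightarrow> covers ys \<and> tour_len ys \<le> tour_len xs" for ys
  \<comment> \<open>A covering tour with the fewest vertices among those no longer than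
    \<open>xs\<close>. Deleting a vertex hidden by a neighbour would give a smaller one, so no
    neighbouring caps are nested.\<close>
  obtain zs where zs: "P zs" "\<And>ys. P ys \<Longrightarrow> length zs \<le> length ys"
    using ex_has_least_nat[of P xs length] assms by (auto simp: P_def)
  have cov: "covers zs" and len: "tour_len zs \<le> tour_len xs" using zs(1) by (auto simp: P_def)
  obtain p0 :: "real^3" where p0: "norm p0 = 1" using vector_choose_size[of 1] by auto
  then have p0_ne: "p0 \<noteq> 0" by auto
  have "zs \<noteq> []" using cov p0 by (auto simp: covers_def)
  then obtain a cs where zs_eq: "zs = a # cs" by (meson neq_Nil_conv)
  have opposite: "\<exists>y\<in>set zs. \<not> norm p \<le> inner y p" if "p \<noteq> 0" for p
  proof -
    have "norm ((- 1 / norm p) *\<^sub>R p) = 1" using that by simp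
    then obtain y where "y \<in> set zs" "1 \<le> inner y ((- 1 / norm p) *\<^sub>R p)"
      using cov unfolding covers_def by blast
    then have "norm p \<le> - inner y p" using that by (simp add: field_simps)
    moreover have "0 < norm p" using that by simp
    ultimately show ?thesis using \<open>y \<in> set zs\<close> by (intro bexI[of _ y]) linarith+
  qed
  have same: "\<exists>y\<in>set zs. norm p \<le> inner y p" if "p \<noteq> 0" for p
  proof -
    have "norm ((1 / norm p) *\<^sub>R p) = 1" using that by simp
    then obtain y where "y \<in> set zs" "1 \<le> inner y ((1 / norm p) *\<^sub>R p)"
      using cov unfolding covers_def by blast
    then show ?thesis using that by (intro bexI[of _ y]) (auto simp: field_simps)
  qed
  have nonnested: "\<not> cap x 1 \<subseteq> cap y 1 \<and> \<not> cap y 1 \<subseteq> cap x 1"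
    if dec: "zs @ [a] = as @ x # y # bs" for as x y bs
  proof -
    \<comment> \<open>A cyclic rotation moves the edge to the front, where the deletion lemma
      applies. Empty \<open>bs\<close> is the closing edge; a tour with a single vertex cannot cover
      two opposite directions.\<close>
    have "\<exists>ds. tour_len (x # y # ds) = tour_len zs \<and> set (x # y # ds) = set zs \<and> length (x # y # ds) = length zs"
    proof (cases bs rule: rev_cases)
      case Nil
      then have *: "zs = as @ [x]" "y = a" using dec by auto
      show ?thesis
      proof (cases as)
        case Nil
        then have "zs = [x]" using * by simp
        then show ?thesis using opposite[OF p0_ne] same[OF p0_ne] by auto
      next
        case (Cons w as')
        then have "zs = [y] @ as' @ [x]" using * zs_eq by simp
        then have "tour_len (x # y # as') = tour_len zs"
          using tour_len_rotate[of "y # as'" "[x]"] by simp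
        then show ?thesis using * Cons zs_eq by (intro exI[of _ as']) auto
      qed
    next
      case (snoc bs' w)
      then have *: "zs = as @ x # y # bs'" using dec by (metis append_assoc append_Cons butlast_snoc)
      then have "tour_len (x # y # bs' @ as) = tour_len zs" using tour_len_rotate[of as "x # y # bs'"] by simp
      then show ?thesis using * by (intro exI[of _ "bs' @ as"]) auto
    qed
    then obtain ds where ds: "tour_len (x # y # ds) = tour_len zs" "set (x # y # ds) = set zs"
      "length (x # y # ds) = length zs" by blast
    have "\<not> P (x # ds)" "\<not> P (y # ds)" using zs(2)[of "x # ds"] zs(2)[of "y # ds"] ds(3) by auto
    moreover have "tour_len (x # ds) \<le> tour_len xs" "tour_len (y # ds) \<le> tour_len xs"
      using tour_len_delete[where x=x and y=y and bs=ds] ds(1) len by linarith+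
    ultimately have "\<not> covers (x # ds)" "\<not> covers (y # ds)" by (auto simp: P_def)
    then show ?thesis using covers_delete[OF cov, of y x "y # ds"] covers_delete[OF cov, of x y "x # ds"] ds(2) by auto
  qed
  define S where "S x y = sym_diff (cap x 1) (cap y 1)" for x y
  have S: "S x y \<in> lmeasurable" for x y by (auto simp: S_def intro!: fmeasurable.Un fmeasurable.Diff)
  have "path_sum (\<lambda>x y. measure lebesgue (S x y)) (zs @ [a])
      \<le> path_sum (\<lambda>x y. 4 * pi / (9 * sqrt 3) * norm (y - x)) (zs @ [a])"
  proof (rule path_sum_mono)
    fix as x y bs assume "zs @ [a] = as @ x # y # bs"
    from nonnested[OF this] edge_cap_cases[of x y]
    show "measure lebesgue (S x y) \<le> 4 * pi / (9 * sqrt 3) * norm (y - x)" unfolding S_def by blast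
  qed
  also have "\<dots> = 4 * pi / (9 * sqrt 3) * tour_len zs"
    unfolding path_sum_cmult by (simp add: tour_len_def zs_eq)
  finally have upper: "path_sum (\<lambda>x y. measure lebesgue (S x y)) (zs @ [a]) \<le> 4 * pi / (9 * sqrt 3) * tour_len zs" .
  have ball_m: "ball (0::real^3) 1 - {0} \<in> lmeasurable" by (rule lmeasurable_subset_ball) auto
  \<comment> \<open>Twice the volume of the ball: each of its nonzero points is in the difference
    set of at least two edges. The origin is removed because it belongs to every sector.\<close>
  have "8 * pi / 3 = (LINT p|lebesgue. 2 * indicat_real (ball (0::real^3) 1 - {0}) p)"
  proof -
    have "measure lebesgue (ball (0::real^3) 1 - {0}) = measure lebesgue (ball (0::real^3) 1)"
      by (rule measure_Diff_null_set) auto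
    also have "\<dots> = 4 * pi / 3" using sphere_volume[of 1 "0::real^3"] by (simp add: measure_completion)
    finally show ?thesis by simp
  qed
  also have "\<dots> \<le> (LINT p|lebesgue. path_sum (\<lambda>x y. indicator (S x y) p) (zs @ [a]))"
  proof (rule integral_mono)
    show "integrable lebesgue (\<lambda>p. 2 * indicat_real (ball (0::real^3) 1 - {0}) p)"
      using ball_m by (intro integrable_mult_right integrable_real_indicator) (auto simp: fmeasurable_def)
    show "integrable lebesgue (\<lambda>p. path_sum (\<lambda>x y. indicat_real (S x y) p) (zs @ [a]))"
      by (rule integral_path_sum(1)[OF S])
    fix p :: "real^3"
    show "2 * indicat_real (ball 0 1 - {0}) p \<le> path_sum (\<lambda>x y. indicat_real (S x y) p) (zs @ [a])"
    proof (cases "p \<in> ball 0 1 - {0}")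
      case True
      define Q where "Q x \<longleftrightarrow> p \<in> cap x 1" for x
      have Qx: "Q x \<longleftrightarrow> norm p \<le> inner x p" for x using True by (auto simp: Q_def cap_def)
      obtain x where x: "x \<in> set (a # cs)" "Q x \<noteq> Q a"
      proof (cases "Q a")
        case True
        then show ?thesis using opposite[of p] \<open>p \<in> ball 0 1 - {0}\<close> that unfolding Qx zs_eq by blast
      next
        case False
        then show ?thesis using same[of p] \<open>p \<in> ball 0 1 - {0}\<close> that unfolding Qx zs_eq by blast
      qed
      have "indicat_real (S x y) p = of_bool (Q x \<noteq> Q y)" for x y
        by (auto simp: S_def Q_def indicator_def)
      then show ?thesis using flips_closed_ge_2[of x a cs Q, OF x] True by (simp add: zs_eq)
    next
      case False
      then show ?thesis using path_sum_nonneg[of "\<lambda>x y. indicat_real (S x y) p"] by simp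
    qed
  qed
  also have "\<dots> = path_sum (\<lambda>x y. measure lebesgue (S x y)) (zs @ [a])"
    by (rule integral_path_sum(2)[OF S])
  also note upper
  finally have "8 * pi / 3 \<le> 4 * pi / (9 * sqrt 3) * tour_len zs" .
  then have "6 * sqrt 3 \<le> tour_len zs" by (simp add: field_simps)
  then show ?thesis using len by simp
qed

subsection \<open>From curves to polygons\<close>

lemma path_len_map_upt:
  "path_len (map z [0..<Suc n]) = (\<Sum>k<n. norm (z (Suc k) - z k))"
proof (induction n)
  case (Suc n)
  have "path_len (map z [0..<Suc n] @ [z (Suc n)])
      = path_len (map z [0..<Suc n]) + norm (z (Suc n) - last (map z [0..<Suc n]))"
    by (rule path_sum_snoc) simp
  moreover have "last (map z [0..<Suc n]) = z n" by simp
  ultimately show ?case using Suc.IH by simp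
qed simp

lemma hull_support_point:
  fixes S :: "'a::real_inner set"
  assumes "y \<in> convex hull S"
  shows "\<exists>s\<in>S. inner p y \<le> inner p s"
proof (rule ccontr)
  assume "\<not> ?thesis"
  then have "S \<subseteq> {s. inner p s < inner p y}" by auto
  then have "convex hull S \<subseteq> {s. inner p s < inner p y}" by (intro hull_minimal convex_halfspace_lt)
  then show False using assms by auto
qed

text \<open>The gap between \<open>c\<close> and \<rho> allows strict inequalities, hence open sets
  \<open>U s\<close>. They cover the unit sphere because in each direction some curve point is at
  least as far out as the point of the sphere of radius \<rho>. Compactness leaves finitely many
  times, to which the end points are added.\<close>

lemma inscribed_polygon:
  fixes \<gamma> :: "real \<Rightarrow> real^3"
  assumes ab: "a \<le> b" and hull: "sphere x \<rho> \<subseteq> convex hull (\<gamma> ` {a..b})" and c: "0 < c" "c < \<rho>"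
  obtains n t where "t 0 = a" "t n = b" "\<forall>i<n. t i \<le> t (Suc i)"
    "\<And>p. norm p = 1 \<Longrightarrow> \<exists>i\<le>n. 1 < inner p ((1 / c) *\<^sub>R (\<gamma> (t i) - x))"
proof -
  define U where "U s = {p. c < inner p (\<gamma> s - x)}" for s
  have "open (U s)" for s unfolding U_def by (intro open_Collect_less continuous_intros)
  moreover have "sphere 0 1 \<subseteq> (\<Union>s\<in>{a..b}. U s)"
  proof
    fix p :: "real^3" assume "p \<in> sphere 0 1"
    then have p: "inner p p = 1" and np: "norm p = 1" by (simp_all add: norm_eq_1)
    have "x + \<rho> *\<^sub>R p \<in> convex hull (\<gamma> ` {a..b})" using hull c np by (auto simp: dist_norm)
    from hull_support_point[OF this, of p] obtain s where "s \<in> {a..b}" "inner p (x + \<rho> *\<^sub>R p) \<le> inner p (\<gamma> s)" by auto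
    then show "p \<in> (\<Union>s\<in>{a..b}. U s)" using p c
      by (intro UN_I[of s]) (auto simp: U_def inner_add_right inner_diff_right)
  qed
  ultimately obtain T where T: "T \<subseteq> {a..b}" "finite T" "sphere 0 1 \<subseteq> (\<Union>s\<in>T. U s)"
    using compactE_image[OF compact_sphere, of "{a..b}" U 0 1] by blast
  define ts where "ts = sorted_list_of_set (insert a (insert b T))"
  have set_ts: "set ts = insert a (insert b T)" and sorted: "sorted ts" 
    using T(2) by (simp_all add: ts_def del: sorted_list_of_set_insert_remove)
  then have ne: "ts \<noteq> []" by auto
  define n where "n = length ts - 1"
  have len: "length ts = Suc n" using ne by (simp add: n_def)
  have bounds: "a \<le> ts ! i \<and> ts ! i \<le> b" if "i \<le> n" for i
    using that nth_mem[of i ts] set_ts T(1) ab len by auto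
  show thesis
  proof (rule that[of "\<lambda>i. ts ! i" n])
    obtain i where "i \<le> n" "ts ! i = a" using set_ts len by (metis in_set_conv_nth insertI1 less_Suc_eq_le)
    then show "ts ! 0 = a" using sorted_nth_mono[OF sorted, of 0 i] bounds[of 0] len by auto
    obtain j where "j \<le> n" "ts ! j = b" using set_ts len by (metis in_set_conv_nth insertI1 insertI2 less_Suc_eq_le)
    then show "ts ! n = b" using sorted_nth_mono[OF sorted, of j n] bounds[of n] len by auto
    show "\<forall>i<n. ts ! i \<le> ts ! Suc i" using sorted len by (auto intro: sorted_nth_mono)
    fix p :: "real^3" assume "norm p = 1"
    then obtain s where "s \<in> T" "c < inner p (\<gamma> s - x)" using T(3) by (force simp: U_def)
    moreover obtain i where "i \<le> n" "ts ! i = s" using \<open>s \<in> T\<close> set_ts len by (metis in_set_conv_nth insertI2 less_Suc_eq_le)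
    ultimately show "\<exists>i\<le>n. 1 < inner p ((1 / c) *\<^sub>R (\<gamma> (ts ! i) - x))"
      using c by (intro exI[of _ i]) (simp add: inner_scaleR_right pos_less_divide_eq del: scaleR_right_diff_distrib)
  qed
qed

theorem theorem1p2:
  fixes \<gamma> :: "real \<Rightarrow> real^3" and a b :: real
  assumes "a \<le> b" and "continuous_on {a..b} \<gamma>" and "rectifiable \<gamma> a b"
  shows "curve_length \<gamma> a b \<ge> sqrt ((pi + 2)\<^sup>2 + 36) * inradius \<gamma> a b
         \<and> (\<gamma> a = \<gamma> b \<longrightarrow> curve_length \<gamma> a b \<ge> 6 * sqrt 3 * inradius \<gamma> a b)"
proof -
  define L where "L = curve_length \<gamma> a b"
  have bdd: "bdd_above (polygon_lengths \<gamma> a b)" using assms(3) by (simp add: rectifiable_def)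
  have upper: "(\<Sum>k<n. norm (\<gamma> (t (Suc k)) - \<gamma> (t k))) \<le> L"
    if "t 0 = a" "t n = b" "\<forall>i<n. t i \<le> t (Suc i)" for n t
  proof -
    have "(\<Sum>k<n. norm (\<gamma> (t (Suc k)) - \<gamma> (t k))) = (\<Sum>i\<in>{1..n}. norm (\<gamma> (t i) - \<gamma> (t (i - 1))))"
      by (rule sum.reindex_bij_witness[of _ "\<lambda>i. i - 1" Suc]) auto
    then have "(\<Sum>k<n. norm (\<gamma> (t (Suc k)) - \<gamma> (t k))) \<in> polygon_lengths \<gamma> a b"
      using that unfolding polygon_lengths_def by blast
    then show ?thesis unfolding L_def curve_length_def using bdd by (rule cSup_upper)
  qed
  have L0: "0 \<le> L"
    using upper[of "\<lambda>i. if i = 0 then a else b" 1] assms(1)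
      order_trans[OF norm_ge_zero[of "\<gamma> b - \<gamma> a"], of L] by simp
  have inscribed: "sqrt ((pi + 2)\<^sup>2 + 36) * c \<le> L" "\<gamma> a = \<gamma> b \<Longrightarrow> 6 * sqrt 3 * c \<le> L"
    if hyp: "sphere x \<rho> \<subseteq> convex hull (\<gamma> ` {a..b})" "0 < c" "c < \<rho>" for x \<rho> c
  proof -
    obtain n t where t: "t 0 = a" "t n = b" "\<forall>i<n. t i \<le> t (Suc i)"
      and cov: "\<And>p. norm p = 1 \<Longrightarrow> \<exists>i\<le>n. 1 < inner p ((1 / c) *\<^sub>R (\<gamma> (t i) - x))"
      by (rule inscribed_polygon[OF assms(1) hyp]) (rule that)
    define z where "z k = (1 / c) *\<^sub>R (\<gamma> (t k) - x)" for k
    have "(\<Sum>k<n. norm (z (Suc k) - z k)) = (\<Sum>k<n. norm (\<gamma> (t (Suc k)) - \<gamma> (t k))) / c"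
      using hyp(2) by (simp add: z_def scaleR_diff_right[symmetric] sum_divide_distrib)
    also have "\<dots> \<le> L / c" using upper[OF t] hyp(2) by (intro divide_right_mono) auto
    finally have len: "(\<Sum>k<n. norm (z (Suc k) - z k)) \<le> L / c" .
    have "sqrt ((pi + 2)\<^sup>2 + 36) \<le> L / c"
      using open_polygon_length_ge[of n z] cov len by (auto simp: z_def)
    then show "sqrt ((pi + 2)\<^sup>2 + 36) * c \<le> L" using hyp(2) by (simp add: pos_le_divide_eq)
    assume closed: "\<gamma> a = \<gamma> b"
    define zs where "zs = map z [0..<Suc n]"
    have "covers zs"
      unfolding covers_def
    proof (intro allI impI)
      fix p :: "real^3" assume "norm p = 1"
      from cov[OF this] obtain i where "i \<le> n" "1 < inner p (z i)" by (auto simp: z_def)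
      then show "\<exists>v\<in>set zs. 1 \<le> inner v p" by (intro bexI[of _ "z i"]) (auto simp: zs_def inner_commute simp del: upt_Suc)
    qed
    then have "6 * sqrt 3 \<le> tour_len zs" by (rule closed_polygon_length_ge)
    also have "tour_len zs = path_len zs + norm (hd zs - last zs)"
      unfolding tour_len_def by (rule path_sum_snoc) (simp add: zs_def)
    \<comment> \<open>For a closed curve the closing edge of the tour has length 0.\<close>
    also have "hd zs = last zs" using t closed by (simp add: zs_def hd_map last_map z_def del: upt_Suc)
    also have "path_len zs = (\<Sum>k<n. norm (z (Suc k) - z k))" unfolding zs_def by (rule path_len_map_upt)
    finally have "6 * sqrt 3 \<le> L / c" using len by simp
    then show "6 * sqrt 3 * c \<le> L" using hyp(2) by (simp add: pos_le_divide_eq)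
  qed
  have inradius_le: "K * inradius \<gamma> a b \<le> L"
    if K: "0 < K" "\<And>x \<rho> c. sphere x \<rho> \<subseteq> convex hull (\<gamma> ` {a..b}) \<Longrightarrow> 0 < c \<Longrightarrow> c < \<rho> \<Longrightarrow> K * c \<le> L" for K
  proof -
    \<comment> \<open>Each admissible radius is approached by the smaller values \<open>c\<close>;
      for the element 0 of the set the bound is \<open>L0\<close>.\<close>
    have "inradius \<gamma> a b \<le> L / K"
      unfolding inradius_def
    proof (rule cSup_least)
      fix r assume "r \<in> {0} \<union> {\<rho>. 0 < \<rho> \<and> (\<exists>x. sphere x \<rho> \<subseteq> convex hull (\<gamma> ` {a..b}) \<and> sphere x \<rho> \<inter> \<gamma> ` {a..b} = {})}"
      then consider "r = 0" | x where "0 < r" "sphere x r \<subseteq> convex hull (\<gamma> ` {a..b})" by auto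
      then show "r \<le> L / K"
      proof cases
        case 1
        then show ?thesis using L0 K by simp
      next
        case 2
        show ?thesis
        proof (rule dense_le_bounded[OF 2(1)])
          fix c assume "0 < c" "c < r"
          then show "c \<le> L / K" using K(2)[OF 2(2), of c] K(1) by (simp add: field_simps)
        qed
      qed
    qed simp
    then show ?thesis using K(1) by (simp add: field_simps)
  qed
  show ?thesis
    unfolding L_def[symmetric]
  proof (intro conjI impI)
    have "0 < (pi + 2)\<^sup>2 + 36" by (simp add: add_nonneg_pos)
    then show "sqrt ((pi + 2)\<^sup>2 + 36) * inradius \<gamma> a b \<le> L"
      using inscribed(1) by (intro inradius_le) auto
    assume "\<gamma> a = \<gamma> b"
    then show "6 * sqrt 3 * inradius \<gamma> a b \<le> L"
      using inscribed(2) by (intro inradius_le) auto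
  qed
qed

end
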